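(* Let $n\ge 2$, let $\Omega_n=\mathbb{R}^{n-1}\times(0,1)=\{x=(x_1,\dots,x_n)\in\mathbb{R}^n:\ 0<x_n<1\}$, let $f:\mathbb{R}\to\mathbb{R}$ be a locally Lipschitz continuous function and let $u$ be a bounded $C^2(\overline{\Omega_n})$ solution of the equation $$\Delta u+f(u)=0\quad\text{in }\Omega_n.$$ Suppose that, for some constant $c>0$, $u=0$ on $\{x_n=0\}$ and $u=c$ on $\{x_n=1\}$. Suppose also that $u$ is non-decreasing with respect to the variable $x_n$, namely $\frac{\partial u}{\partial x_n}\ge0$ in $\overline{\Omega_n}$. Then $u$ is a function of $x_n$ only, that is, $u(x_1,\dots,x_n)=\tilde{u}(x_n)$ in $\overline{\Omega_n}$ for some function $\tilde u$ on $[0,1]$, and $\tilde{u}'(x_n)>0$ for all $0<x_n<1$.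
   Context: $C^2(\overline{\Omega_n})$ means that all partial derivatives up to order $2$ exist and are continuous up to the boundary (they are not assumed bounded). *)

theory Defs
  imports "HOL-Analysis.Analysis"
begin

text \<open>
  Points of the n-dimensional space are written as pairs of type
  \<^typ>\<open>(real ^ 'm) \<times> real\<close>, whose norm is the Euclidean one; so n = CARD('m) + 1, which
  ranges over all integers \<open>\<ge> 2\<close>, and the last coordinate is the second component.
\<close>

definition strip :: "((real ^ 'm) \<times> real) set"
  where "strip = UNIV \<times> {0<..<1}"

text \<open>
  Partial derivatives at points of \<open>S\<close>, taken within \<open>S\<close>: ordinary ones at interior points,
  one-sided ones where the line in direction \<open>b\<close> leaves \<open>S\<close>. They are only meaningful if \<open>0\<close> is a
  limit point of \<open>{t. x + t *\<^sub>R b \<in> S}\<close> for all \<open>x\<close> in \<open>S\<close>, as is the case for the strip and its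
  closure. Values of \<open>u\<close> outside \<open>S\<close> play no role.
\<close>

definition partial_exists :: "'a::euclidean_space set \<Rightarrow> 'a \<Rightarrow> ('a \<Rightarrow> real) \<Rightarrow> 'a \<Rightarrow> bool"
  where "partial_exists S b u x \<longleftrightarrow>
    (\<lambda>t::real. u (x + t *\<^sub>R b)) differentiable (at 0 within {t. x + t *\<^sub>R b \<in> S})"

definition partial :: "'a::euclidean_space set \<Rightarrow> 'a \<Rightarrow> ('a \<Rightarrow> real) \<Rightarrow> 'a \<Rightarrow> real"
  where "partial S b u x =
    vector_derivative (\<lambda>t::real. u (x + t *\<^sub>R b)) (at 0 within {t. x + t *\<^sub>R b \<in> S})"

text \<open>
  With \<open>S\<close> the closed strip, \<open>Ck_on k S\<close> is the space of functions all of whose partial derivatives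
  up to order \<open>k\<close> exist and are continuous up to the boundary; no boundedness is required.
\<close>

primrec Ck_on :: "nat \<Rightarrow> 'a::euclidean_space set \<Rightarrow> ('a \<Rightarrow> real) \<Rightarrow> bool"
  where
    "Ck_on 0 S u \<longleftrightarrow> continuous_on S u"
  | "Ck_on (Suc k) S u \<longleftrightarrow> continuous_on S u \<and>
       (\<forall>b\<in>Basis. (\<forall>x\<in>S. partial_exists S b u x) \<and> Ck_on k S (partial S b u))"

definition laplacian :: "'a::euclidean_space set \<Rightarrow> ('a \<Rightarrow> real) \<Rightarrow> 'a \<Rightarrow> real"
  where "laplacian S u x = (\<Sum>b\<in>Basis. partial S b (partial S b u) x)"

lemma closure_strip: "closure (strip :: ((real ^ 'm) \<times> real) set) = UNIV \<times> {0..1}"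
  by (simp add: strip_def closure_Times)

end

theory Submission
  imports Defs
begin

text \<open>
  The proof is the sliding method. Fix a horizontal vector \<open>\<xi>\<close> and compare \<open>u\<close> with its translate
  \<open>u(x + \<xi>, y + \<tau>)\<close> on the strip \<open>0 \<le> y \<le> 1 - \<tau>\<close>. Claim: the translate lies above \<open>u\<close> for every
  \<open>\<tau>\<close> between 0 and 1. For \<open>\<tau> = 0\<close> and all \<open>\<xi>\<close> this says that \<open>u\<close> does not depend on the horizontal
  variables. On the boundary of the strip the comparison holds because \<open>0 \<le> u \<le> c\<close>, which follows
  from monotonicity in the last variable. For \<open>\<tau>\<close> near 1 the strip is narrow and the maximum principle
  applies (\<open>narrow_maximum_principle\<close>). Let \<open>\<tau>\<close> be the least admissible shift and suppose
  that it is positive. If the difference of the two functions is bounded away from \<open>0\<close> inside the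
  strip, then \<open>\<tau>\<close> can be lowered, by the maximum principle in the two narrow strips along the
  boundary (\<open>slide_further\<close>); this contradicts minimality.

  The difficulty is the positive lower bound on an unbounded domain
  (\<open>gap_bounded_below_inside\<close>). The usual route passes to a limit of translates and
  needs elliptic regularity. Instead, every step here is quantitative. First, \<open>u\<close> is globally
  Lipschitz (\<open>lipschitz\<close>): comparing \<open>u\<close> with its reflections in coordinate hyperplanes and
  with quadratic barriers bounds its difference quotients by the bounds on \<open>u\<close> and \<open>\<Delta>u\<close>.
  Secondly, a nonnegative Lipschitz function with \<open>\<Delta>w \<le> L w\<close> that is at least \<open>m\<close> at one point has a
  positive lower bound at all points within a given distance, and the bound does not depend on
  the position of the point (\<open>propagation_of_positivity\<close>). So if the difference is very small at one
  point, it is small on a large region. Following the steps \<open>(\<xi>, \<tau>)\<close> upwards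
  from the lower boundary, \<open>u\<close> is then still small at some height \<open>\<ge> 1 - \<tau>\<close>, while one step from the
  upper boundary shows that it is close to \<open>c\<close> at height \<open>1 - \<tau>\<close>. This contradicts monotonicity.

  Finally the profile solves an ordinary differential equation with a Lipschitz nonlinearity, and a
  zero of its nonnegative derivative would force it to be constant (\<open>v_deriv_pos\<close>).
\<close>

section \<open>Pointwise Laplacians\<close>

text \<open>
  A second derivative at \<open>0\<close> is a relation here, so that one formula states that it exists and
  what it is; the same holds for the Laplacian below, the sum of the pure second derivatives.
  This is what a comparison argument needs: the Laplacian is linear, it commutes with translations
  and coordinate reflections, and it is nonnegative at a local minimum.
\<close>

definition has_deriv2 :: "(real \<Rightarrow> real) \<Rightarrow> real \<Rightarrow> bool"
  where "has_deriv2 g l \<longleftrightarrow> (\<exists>g'. (\<forall>\<^sub>F t in nhds 0. (g has_real_derivative g' t) (at t)) \<and>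
     (g' has_real_derivative l) (at 0))"

definition has_lap :: "('a::euclidean_space \<Rightarrow> real) \<Rightarrow> 'a \<Rightarrow> real \<Rightarrow> bool"
  where "has_lap w x l \<longleftrightarrow>
    (\<exists>d. (\<forall>b\<in>Basis. has_deriv2 (\<lambda>t. w (x + t *\<^sub>R b)) (d b)) \<and> l = sum d Basis)"

lemma has_deriv2I:
  assumes "\<forall>\<^sub>F t in nhds 0. (g has_real_derivative g' t) (at t)"
    and "(g' has_real_derivative l) (at 0)"
  shows "has_deriv2 g l"
  using assms unfolding has_deriv2_def by blast

lemma has_deriv2_add:
  assumes "has_deriv2 g k" "has_deriv2 h l"
  shows "has_deriv2 (\<lambda>t. g t + h t) (k + l)"
proof -
  from assms obtain g' h' where
    g': "\<forall>\<^sub>F t in nhds 0. (g has_real_derivative g' t) (at t)" and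
    h': "\<forall>\<^sub>F t in nhds 0. (h has_real_derivative h' t) (at t)"
    and d: "(g' has_real_derivative k) (at 0)" "(h' has_real_derivative l) (at 0)"
    unfolding has_deriv2_def by auto
  have "\<forall>\<^sub>F t in nhds 0. ((\<lambda>t. g t + h t) has_real_derivative (g' t + h' t)) (at t)"
    using eventually_conj[OF g' h'] by (rule eventually_mono) (auto intro: DERIV_add)
  then show ?thesis by (rule has_deriv2I) (rule DERIV_add[OF d])
qed

lemma has_deriv2_cmult:
  assumes "has_deriv2 g k"
  shows "has_deriv2 (\<lambda>t. c * g t) (c * k)"
proof -
  from assms obtain g' where
    "\<forall>\<^sub>F t in nhds 0. (g has_real_derivative g' t) (at t)"
    and d: "(g' has_real_derivative k) (at 0)"
    unfolding has_deriv2_def by auto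
  then have "\<forall>\<^sub>F t in nhds 0. ((\<lambda>t. c * g t) has_real_derivative c * g' t) (at t)"
    by (auto elim!: eventually_mono intro: DERIV_cmult)
  then show ?thesis by (rule has_deriv2I) (rule DERIV_cmult[OF d])
qed

lemma has_deriv2_mirror:
  assumes "has_deriv2 g k"
  shows "has_deriv2 (\<lambda>t. g (- t)) k"
proof -
  from assms obtain g' where
    ev: "\<forall>\<^sub>F t in nhds 0. (g has_real_derivative g' t) (at t)"
    and d: "(g' has_real_derivative k) (at 0)"
    unfolding has_deriv2_def by auto
  have "filterlim uminus (nhds 0) (nhds (0::real))"
    using tendsto_minus[OF filterlim_ident, of "0::real"] by simp
  then have "\<forall>\<^sub>F t in nhds 0. (g has_real_derivative g' (- t)) (at (- t))"
    using eventually_compose_filterlim[OF ev] by blast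
  then have "\<forall>\<^sub>F t in nhds 0. ((\<lambda>t. g (- t)) has_real_derivative - g' (- t)) (at t)"
    by (rule eventually_mono) (simp add: DERIV_mirror)
  moreover have "((\<lambda>t. - g' (- t)) has_real_derivative k) (at 0)"
    using DERIV_minus[OF DERIV_mirror[THEN iffD1, of g' k 0]] d by simp
  ultimately show ?thesis by (rule has_deriv2I)
qed

lemma has_deriv2_quadratic: "has_deriv2 (\<lambda>t. A + B * t + C * t\<^sup>2) (2 * C)"
  unfolding has_deriv2_def
  by (rule exI[of _ "\<lambda>t. B + 2 * C * t"])
     (auto intro!: derivative_eq_intros always_eventually)

lemma has_deriv2_const: "has_deriv2 (\<lambda>t. A) 0"
  using has_deriv2_quadratic[of A 0 0] by simp

text \<open>
  The first derivative vanishes at \<open>0\<close>. If the second were negative, the first would be negative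
  just to the right of \<open>0\<close>, and the function would decrease there by the mean value theorem.
\<close>

lemma has_deriv2_local_min:
  assumes "has_deriv2 g l" and "\<forall>\<^sub>F t in nhds 0. g 0 \<le> g t"
  shows "l \<ge> 0"
proof (rule ccontr)
  assume "\<not> l \<ge> 0"
  then have l: "l < 0" by simp
  from assms obtain g' where
    ev: "\<forall>\<^sub>F t in nhds 0. (g has_real_derivative g' t) (at t)"
    and d: "(g' has_real_derivative l) (at 0)"
    unfolding has_deriv2_def by auto
  from eventually_conj[OF ev assms(2)] obtain e where e: "e > 0"
    "\<And>t. \<bar>t\<bar> < e \<Longrightarrow> (g has_real_derivative g' t) (at t)"
    "\<And>t. \<bar>t\<bar> < e \<Longrightarrow> g 0 \<le> g t"
    unfolding eventually_nhds_metric by (auto simp: dist_real_def)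
  have g0: "g' 0 = 0"
    by (rule DERIV_local_min[OF e(2) \<open>e > 0\<close>]) (use e in auto)
  obtain r where r: "r > 0" "\<And>h. h > 0 \<Longrightarrow> h < r \<Longrightarrow> g' h < 0"
    using DERIV_neg_dec_right[OF d l] g0 by auto
  define h where "h = min e r / 2"
  have h: "h > 0" "h < e" "h < r" using e r by (auto simp: h_def)
  obtain z where z: "0 < z" "z < h" "g h - g 0 = (h - 0) * g' z"
    using MVT2[of 0 h g g'] h e(2) by auto
  have "g' z < 0" using r(2)[of z] z h by auto
  then have "g h < g 0" using z h by (smt (verit) mult_pos_neg)
  with e(3)[of h] h show False by auto
qed

lemma has_lap_add:
  assumes "has_lap v x k" "has_lap w x l"
  shows "has_lap (\<lambda>x. v x + w x) x (k + l)"
proof -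
  from assms obtain d e where "\<forall>b\<in>Basis. has_deriv2 (\<lambda>t. v (x + t *\<^sub>R b)) (d b)" "k = sum d Basis"
    "\<forall>b\<in>Basis. has_deriv2 (\<lambda>t. w (x + t *\<^sub>R b)) (e b)" "l = sum e Basis"
    unfolding has_lap_def by auto
  then show ?thesis
    unfolding has_lap_def
    by (intro exI[of _ "\<lambda>b. d b + e b"]) (auto simp: sum.distrib intro: has_deriv2_add)
qed

lemma has_lap_cmult:
  assumes "has_lap w x l"
  shows "has_lap (\<lambda>x. c * w x) x (c * l)"
proof -
  from assms obtain e where 
    "\<forall>b\<in>Basis. has_deriv2 (\<lambda>t. w (x + t *\<^sub>R b)) (e b)" "l = sum e Basis"
    unfolding has_lap_def by auto
  then show ?thesis
    unfolding has_lap_def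
    by (intro exI[of _ "\<lambda>b. c * e b"]) (auto simp: sum_distrib_left intro: has_deriv2_cmult)
qed

lemma has_lap_diff:
  assumes "has_lap v x k" "has_lap w x l"
  shows "has_lap (\<lambda>x. v x - w x) x (k - l)"
  using has_lap_add[OF assms(1) has_lap_cmult[OF assms(2), of "-1"]] by simp

lemma has_lap_translate:
  assumes "has_lap w (x + a) l"
  shows "has_lap (\<lambda>x. w (x + a)) x l"
  using assms unfolding has_lap_def by (simp add: add_ac)

definition reflection :: "real \<Rightarrow> 'a \<Rightarrow> 'a \<Rightarrow> 'a::euclidean_space"
  where "reflection a b x = x + (2 * (a - x \<bullet> b)) *\<^sub>R b"

lemma has_lap_reflection:
  assumes "b \<in> Basis" "has_lap w (reflection a b x) l"
  shows "has_lap (\<lambda>x. w (reflection a b x)) x l"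
proof -
  from assms obtain d where d: 
    "\<forall>b'\<in>Basis. has_deriv2 (\<lambda>t. w (reflection a b x + t *\<^sub>R b')) (d b')" "l = sum d Basis"
    unfolding has_lap_def by auto
  have "has_deriv2 (\<lambda>t. w (reflection a b (x + t *\<^sub>R b'))) (d b')" if b': "b' \<in> Basis" for b'
  proof (cases "b' = b")
    case True
    have "reflection a b (x + t *\<^sub>R b) = reflection a b x + (- t) *\<^sub>R b" for t
      using assms(1)
      by (simp add: reflection_def inner_simps algebra_simps) (metis mult_2_right scaleR_left_distrib)
    then show ?thesis using has_deriv2_mirror[OF d(1)[rule_format, OF b']] True by simp
  next
    case False
    then have "reflection a b (x + t *\<^sub>R b') = reflection a b x + t *\<^sub>R b'" for t
      using assms(1) b' by (simp add: reflection_def inner_simps algebra_simps inner_not_same_Basis)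
    then show ?thesis using d(1) b' by simp
  qed
  with d(2) show ?thesis unfolding has_lap_def by blast
qed

text \<open>
  One-variable quadratics in a coordinate are the barriers of the Lipschitz estimates.
\<close>

lemma has_lap_quadratic_coordinate:
  fixes b x :: "'a::euclidean_space"
  assumes "b \<in> Basis"
  shows "has_lap (\<lambda>p. A + B * (p \<bullet> b) + C * (p \<bullet> b)\<^sup>2) x (2 * C)"
  unfolding has_lap_def
proof (intro exI conjI ballI)
  fix b' :: 'a assume b': "b' \<in> Basis"
  show "has_deriv2 (\<lambda>t. A + B * ((x + t *\<^sub>R b') \<bullet> b) + C * ((x + t *\<^sub>R b') \<bullet> b)\<^sup>2) (if b' = b then 2 * C else 0)"
  proof (cases "b' = b")
    case True
    have eq: "A + B * ((x + t *\<^sub>R b) \<bullet> b) + C * ((x + t *\<^sub>R b) \<bullet> b)\<^sup>2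
      = (A + B * (x \<bullet> b) + C * (x \<bullet> b)\<^sup>2) + (B + 2 * C * (x \<bullet> b)) * t + C * t\<^sup>2" for t
      using assms by (simp add: inner_simps algebra_simps power2_eq_square)
    show ?thesis using True by (simp only: eq has_deriv2_quadratic if_True simp_thms)
  next
    case False
    then show ?thesis using assms b' by (simp add: inner_simps inner_not_same_Basis has_deriv2_const)
  qed
qed (use assms in auto)

lemma has_lap_local_min:
  assumes "has_lap w z l" and "\<forall>\<^sub>F x in nhds z. w z \<le> w x"
  shows "l \<ge> 0"
proof -
  from assms obtain d where d: 
    "\<forall>b\<in>Basis. has_deriv2 (\<lambda>t. w (z + t *\<^sub>R b)) (d b)" "l = sum d Basis"
    unfolding has_lap_def by auto
  have "d b \<ge> 0" if "b \<in> Basis" for b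
  proof (rule has_deriv2_local_min)
    have "filterlim (\<lambda>t. z + t *\<^sub>R b) (nhds z) (nhds 0)"
      by (rule tendsto_eq_intros refl filterlim_ident | simp)+
    from eventually_compose_filterlim[OF assms(2) this]
    show "\<forall>\<^sub>F t in nhds 0. w (z + 0 *\<^sub>R b) \<le> w (z + t *\<^sub>R b)" by simp
  qed (use d that in auto)
  with d(2) show ?thesis by (simp add: sum_nonneg)
qed

lemma has_lap_prodI:
  assumes "\<And>b. b \<in> Basis \<Longrightarrow> has_deriv2 (\<lambda>t. w (x + t *\<^sub>R b, y)) (d b)"
    and "has_deriv2 (\<lambda>t. w (x, y + t)) e"
  shows "has_lap w (x, y) (sum d Basis + e)"
  unfolding has_lap_def
proof (intro exI conjI ballI)
  let ?d = "\<lambda>b. if snd b = (0::real) then d (fst b) else e"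
  show "sum d Basis + e = sum ?d Basis"
    unfolding Basis_prod_def
    by (subst sum.union_disjoint) (auto simp: sum.reindex inj_on_def Basis_real_def)
  fix b :: "'a \<times> real" assume "b \<in> Basis"
  then show "has_deriv2 (\<lambda>t. w ((x, y) + t *\<^sub>R b)) (?d b)"
    using assms by (auto simp: Basis_prod_def)
qed

section \<open>The maximum principle in narrow strips\<close>

text \<open>
  Where \<open>w < 0\<close> we have \<open>\<Delta>w + L w \<le> 0\<close>. On a strip of width \<open>d\<close> with \<open>L d\<^sup>2 < 2\<close> there is a
  positive strict supersolution \<open>\<phi>(x, y) = (1 - \<mu> (y - a)\<^sup>2) (1 + \<epsilon> |x|\<^sup>2)\<close>, that is
  \<open>\<Delta>\<phi> + L \<phi> < 0\<close>. It tends to infinity horizontally, so for a function \<open>w\<close> that is bounded below and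
  negative somewhere the quotient \<open>w / \<phi>\<close> attains a negative minimum \<open>- e\<close>. At such a point
  \<open>w + e \<phi>\<close> has the minimal value \<open>0\<close>, but its Laplacian is negative. The domain \<open>D\<close> may be
  any closed part of the strip, such as a slab cut out by a vertical hyperplane.
\<close>

lemma narrow_maximum_principle:
  fixes w :: "'a::euclidean_space \<times> real \<Rightarrow> real"
  assumes D: "closed D" "D \<subseteq> UNIV \<times> {a..a+d}" and L: "L \<ge> 0" "L * d\<^sup>2 < 2"
    and cont: "continuous_on D w" and bdd: "\<And>p. p \<in> D \<Longrightarrow> w p \<ge> - M"
    and super: "\<And>p. p \<in> D \<Longrightarrow> w p < 0 \<Longrightarrow> p \<in> interior D \<and> (\<exists>l. has_lap w p l \<and> l \<le> - L * w p)"
    and "p \<in> D"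
  shows "w p \<ge> 0"
proof (rule ccontr)
  assume "\<not> w p \<ge> 0"
  then have neg: "w p < 0" by simp
  have "\<exists>\<mu>. 2 * \<mu> > L \<and> \<mu> * d\<^sup>2 < 1"
  proof (cases "d = 0")
    case True
    then show ?thesis using L by (intro exI[of _ "L + 1"]) simp
  next
    case False
    then have d: "d\<^sup>2 > 0" by simp
    have "L / 2 < 1 / d\<^sup>2" using L d by (simp add: field_simps)
    then obtain \<mu> where "L / 2 < \<mu>" "\<mu> < 1 / d\<^sup>2" using dense by blast
    then show ?thesis using d by (auto intro!: exI[of _ \<mu>] simp: field_simps)
  qed
  then obtain \<mu> where \<mu>: "2 * \<mu> > L" "\<mu> * d\<^sup>2 < 1" by blast
  define m where "m = real DIM('a)"
  have m: "m > 0" unfolding m_def by simp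
  \<comment> \<open>The growing factor contributes at most \<open>2 m \<epsilon>\<close> to the Laplacian, which the
    slack \<open>2 \<mu> - L\<close> of the vertical factor absorbs.\<close>
  define \<epsilon> where "\<epsilon> = (2 * \<mu> - L) / (4 * m)"
  have \<epsilon>: "\<epsilon> > 0" "2 * m * \<epsilon> + L < 2 * \<mu>" using \<mu> m by (auto simp: \<epsilon>_def field_simps)
  define g where "g = (\<lambda>y::real. 1 - \<mu> * (y - a)\<^sup>2)"
  define h where "h = (\<lambda>x::'a. 1 + \<epsilon> * (x \<bullet> x))"
  define \<phi> where "\<phi> = (\<lambda>p::'a\<times>real. g (snd p) * h (fst p))"
  define g0 where "g0 = 1 - \<mu> * d\<^sup>2"
  have g0: "g0 > 0" using \<mu> by (simp add: g0_def)
  have mu0: "\<mu> > 0" using \<mu> L by linarith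
  have g: "g0 \<le> g y \<and> g y \<le> 1" if "a \<le> y" "y \<le> a + d" for y
    using that mu0 by (auto simp: g_def g0_def intro!: mult_left_mono power_mono)
  have h: "h x \<ge> 1" for x using \<epsilon> by (simp add: h_def)
  have \<phi>_ge: "\<phi> q \<ge> g0 * h (fst q)" if "q \<in> D" for q
    unfolding \<phi>_def using that D(2) g[of "snd q"] h[of "fst q"] by (intro mult_right_mono) auto
  have \<phi>_pos: "\<phi> q > 0" if "q \<in> D" for q
    using \<phi>_ge[OF that] g0 h[of "fst q"] by (smt (verit) mult_pos_pos)
  define l\<phi> where "l\<phi> = (\<lambda>q::'a\<times>real. m * (2 * \<epsilon> * g (snd q)) + 2 * (- \<mu> * h (fst q)))"
  have lap_\<phi>: "has_lap \<phi> q (l\<phi> q)" for q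
  proof (cases q)
    case (Pair x y)
    have "has_lap \<phi> (x, y) ((\<Sum>b\<in>(Basis::'a set). 2 * (\<epsilon> * g y)) + 2 * (- \<mu> * h x))"
    proof (rule has_lap_prodI)
      fix b :: 'a assume b: "b \<in> Basis"
      have eq: "\<phi> (x + t *\<^sub>R b, y) = g y * h x + (2 * g y * \<epsilon> * (x \<bullet> b)) * t + (\<epsilon> * g y) * t\<^sup>2" for t
        using b by (simp add: \<phi>_def h_def inner_simps algebra_simps power2_eq_square inner_commute)
      show "has_deriv2 (\<lambda>t. \<phi> (x + t *\<^sub>R b, y)) (2 * (\<epsilon> * g y))"
        unfolding eq by (rule has_deriv2_quadratic)
    next
      have eq: "\<phi> (x, y + t) = g y * h x + (- 2 * \<mu> * (y - a) * h x) * t + (- \<mu> * h x) * t\<^sup>2" for t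
        by (simp add: \<phi>_def g_def algebra_simps power2_eq_square)
      show "has_deriv2 (\<lambda>t. \<phi> (x, y + t)) (2 * (- \<mu> * h x))"
        unfolding eq by (rule has_deriv2_quadratic)
    qed
    then show ?thesis by (simp add: Pair l\<phi>_def m_def mult.assoc)
  qed
  have l\<phi>_neg: "l\<phi> q + L * \<phi> q < 0" if "q \<in> D" for q
  proof -
    have gq: "0 < g (snd q)" "g (snd q) \<le> 1" using g[of "snd q"] that D(2) g0 by (auto simp: mem_Times_iff)
    have "m * (2 * \<epsilon> * g (snd q)) \<le> (2 * m * \<epsilon>) * 1"
      using gq m \<epsilon> by (simp add: mult_left_le)
    also have "\<dots> \<le> (2 * m * \<epsilon>) * h (fst q)" using m \<epsilon> h by (intro mult_left_mono) auto
    finally have 1: "m * (2 * \<epsilon> * g (snd q)) \<le> (2 * m * \<epsilon>) * h (fst q)" .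
    have 2: "L * \<phi> q \<le> L * h (fst q)"
      unfolding \<phi>_def using gq h[of "fst q"] L by (intro mult_left_mono) (auto simp: mult_left_le_one_le)
    have 3: "(2 * m * \<epsilon> + L - 2 * \<mu>) * h (fst q) < 0" using \<epsilon> h[of "fst q"] by (intro mult_neg_pos) auto
    then show ?thesis using 1 2 unfolding l\<phi>_def by (simp add: algebra_simps)
  qed
  have cont_\<phi>: "continuous_on D \<phi>" unfolding \<phi>_def g_def h_def by (intro continuous_intros)
  define r where "r = (\<lambda>q. w q / \<phi> q)"
  have rp: "r p < 0" using neg \<phi>_pos[OF \<open>p \<in> D\<close>] by (simp add: r_def divide_neg_pos)
  \<comment> \<open>Beyond horizontal radius \<open>K + 1\<close> the lower bound \<open>- M\<close> on \<open>w\<close> forces \<open>r q \<ge> r p\<close>, so the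
    minimum over the compact set \<open>D'\<close> is the minimum over \<open>D\<close>.\<close>
  define K where "K = \<bar>M\<bar> / (- r p * g0 * \<epsilon>)"
  define D' where "D' = D \<inter> ({x. norm x \<le> max (norm (fst p)) (K + 1)} \<times> {a..a+d})"
  have D'_eq: "D' = D \<inter> (cball 0 (max (norm (fst p)) (K + 1)) \<times> {a..a+d})"
    by (auto simp: D'_def)
  have comp: "compact D'"
    unfolding D'_eq by (intro closed_Int_compact D compact_Times compact_cball compact_Icc)
  have pD': "p \<in> D'" using \<open>p \<in> D\<close> D(2) by (auto simp: D'_def mem_Times_iff)
  have "continuous_on D' r" unfolding r_def
    using cont cont_\<phi> \<phi>_pos
    by (intro continuous_on_divide) (auto simp: D'_def intro: continuous_on_subset dest: less_imp_neq[OF \<phi>_pos])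
  then obtain z where z: "z \<in> D'" "\<And>q. q \<in> D' \<Longrightarrow> r z \<le> r q"
    using continuous_attains_inf[OF comp, of r] pD' by blast
  have zD: "z \<in> D" using z by (simp add: D'_def)
  have rz: "r z < 0" using z(2)[OF pD'] rp by simp
  have minimal: "r z \<le> r q" if "q \<in> D" for q
  proof (cases "q \<in> D'")
    case False
    have q: "norm (fst q) > K + 1" using False that D(2) by (auto simp: D'_def mem_Times_iff)
    have "0 < - r p * g0 * \<epsilon>" using rp g0 \<epsilon> by (intro mult_pos_pos) auto
    then have K0: "K \<ge> 0" unfolding K_def by (intro divide_nonneg_pos) auto
    have "K \<le> norm (fst q) * norm (fst q)" using q K0
      by (smt (verit) mult_left_mono mult_cancel_left1)
    then have "K * \<epsilon> \<le> h (fst q)"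
      using \<epsilon> by (simp add: h_def dot_square_norm power2_eq_square add_increasing mult.commute)
    then have "K * \<epsilon> * g0 \<le> \<phi> q"
      using \<phi>_ge[OF that] g0 by (smt (verit, ccfv_SIG) mult.commute mult_left_mono)
    then have "\<bar>M\<bar> / (- r p) \<le> \<phi> q"
      using \<epsilon> g0 rp by (simp add: K_def divide_simps split: if_splits)
    then have "\<bar>M\<bar> \<le> - r p * \<phi> q" using rp by (simp add: field_simps)
    then have "r p * \<phi> q \<le> w q" using bdd[OF that] by linarith
    then have "r p \<le> r q" using \<phi>_pos[OF that] by (simp add: r_def field_simps)
    with z(2)[OF pD'] show ?thesis by simp
  qed (rule z(2))
  define e where "e = - r z"
  have e: "e > 0" using rz by (simp add: e_def)
  have wz: "w z = - e * \<phi> z" using \<phi>_pos[OF zD] by (simp add: e_def r_def)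
  have "w z < 0" using wz e \<phi>_pos[OF zD] by (simp add: mult_neg_pos)
  from super[OF zD this] obtain l where l: "z \<in> interior D" "has_lap w z l" "l \<le> - L * w z" by blast
  have "has_lap (\<lambda>q. w q + e * \<phi> q) z (l + e * l\<phi> z)"
    by (intro has_lap_add has_lap_cmult l lap_\<phi>)
  moreover have "\<forall>\<^sub>F q in nhds z. w z + e * \<phi> z \<le> w q + e * \<phi> q"
  proof (rule eventually_mono)
    show "\<forall>\<^sub>F q in nhds z. q \<in> interior D" using l(1) by (simp add: eventually_nhds_in_open)
    fix q assume "q \<in> interior D"
    then have q: "q \<in> D" using interior_subset by blast
    have "- e \<le> r q" using minimal[OF q] by (simp add: e_def)
    then show "w z + e * \<phi> z \<le> w q + e * \<phi> q"
      using \<phi>_pos[OF q] wz by (simp add: r_def field_simps)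
  qed
  ultimately have "0 \<le> l + e * l\<phi> z" by (rule has_lap_local_min)
  moreover have "l + e * l\<phi> z \<le> e * (l\<phi> z + L * \<phi> z)" using l(3) wz by (simp add: algebra_simps)
  moreover have "e * (l\<phi> z + L * \<phi> z) < 0" using e l\<phi>_neg[OF zD] by (simp add: mult_pos_neg)
  ultimately show False by linarith
qed

section \<open>Global Lipschitz bounds\<close>

text \<open>
  Only a bound \<open>N\<close> on the Laplacian and a bound \<open>c\<close> on the function enter. The class is closed
  under the flip \<open>U(x, y) \<mapsto> c - U(x, 1 - y)\<close>, which exchanges the two boundary hyperplanes.
\<close>

locale bounded_strip_function =
  fixes U :: "'a::euclidean_space \<times> real \<Rightarrow> real" and N c :: real
  assumes cont: "continuous_on (UNIV \<times> {0..1}) U"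
    and bounds: "\<And>x y. 0 \<le> y \<Longrightarrow> y \<le> 1 \<Longrightarrow> 0 \<le> U (x, y) \<and> U (x, y) \<le> c"
    and bottom: "\<And>x. U (x, 0) = 0" and top: "\<And>x. U (x, 1) = c"
    and lap: "\<And>x y. 0 < y \<Longrightarrow> y < 1 \<Longrightarrow> \<exists>l. has_lap U (x, y) l \<and> \<bar>l\<bar> \<le> N"
begin

lemma N_nonneg: "N \<ge> 0"
  using lap[of "1/2" undefined] by force

lemma c_nonneg: "c \<ge> 0"
  using bounds[of 0 undefined] by force

text \<open>
  The barrier \<open>(c + N / 2) y - (N / 2) y\<^sup>2\<close> has Laplacian \<open>- N\<close>, vanishes at \<open>y = 0\<close> and equals
  \<open>c\<close> at \<open>y = 1\<close>.
\<close>

lemma boundary_estimate: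
  assumes "0 \<le> y" "y \<le> 1"
  shows "U (x, y) \<le> (c + N / 2) * y"
proof -
  define w where "w = (\<lambda>p. (0 + (c + N / 2) * (p \<bullet> (0, 1)) + (- N / 2) * (p \<bullet> (0, 1))\<^sup>2) - U p)"
  have bar: "0 \<le> (c + N / 2) * y + (- N / 2) * y\<^sup>2" if "0 \<le> y" "y \<le> 1" for y
  proof -
    have "N / 2 * y\<^sup>2 \<le> N / 2 * y"
      using that N_nonneg by (intro mult_left_mono) (auto simp: power2_eq_square mult_left_le)
    moreover have "0 \<le> c * y" using that c_nonneg by simp
    ultimately show ?thesis by (simp add: algebra_simps)
  qed
  have "w (x, y) \<ge> 0"
  proof (rule narrow_maximum_principle[of "UNIV \<times> {0..1}" 0 1 0 w c])
    show "continuous_on (UNIV \<times> {0..1}) w"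
      unfolding w_def by (intro continuous_intros cont)
  next
    fix p :: "'a \<times> real" assume "p \<in> UNIV \<times> {0..1}"
    then show "w p \<ge> - c"
      using bar[of "snd p"] bounds[of "snd p" "fst p"] by (auto simp: w_def)
  next
    fix p :: "'a \<times> real" assume p: "p \<in> UNIV \<times> {0..1}" "w p < 0"
    obtain x y where xy: "p = (x, y)" by (cases p)
    have "y \<noteq> 0" using p bottom by (auto simp: w_def xy)
    moreover have "y \<noteq> 1" using p top by (auto simp: w_def xy)
    ultimately have y: "0 < y" "y < 1" using p xy by auto
    obtain l where l: "has_lap U p l" "\<bar>l\<bar> \<le> N" using lap[OF y, of x] xy by blast
    have "has_lap w p (2 * (- N / 2) - l)" unfolding w_def
      by (intro has_lap_diff has_lap_quadratic_coordinate l) (simp add: Basis_prod_def)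
    then show "p \<in> interior (UNIV \<times> {0..1}) \<and> (\<exists>l. has_lap w p l \<and> l \<le> - 0 * w p)"
      using l(2) y by (auto simp: xy interior_Times)
  qed (use assms in \<open>auto simp: closed_Times\<close>)
  moreover have "0 \<le> N / 2 * y\<^sup>2" using N_nonneg by simp
  ultimately show ?thesis by (simp add: w_def)
qed

text \<open>
  The difference between \<open>U\<close> and its reflection in the hyperplane \<open>x \<bullet> b = \<alpha>\<close> vanishes on this
  hyperplane and on the boundary of the strip, and its Laplacian is at most \<open>2 N\<close> in absolute value.
  So in the slab of width 1 next to the hyperplane it lies below \<open>(c + N) s - N s\<^sup>2\<close>, where \<open>s\<close> is the
  distance to the hyperplane. This is a gradient estimate that does not differentiate the equation.
  The sign \<open>\<sigma>\<close> gives both bounds at once.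
\<close>

lemma reflection_estimate_horizontal:
  assumes b: "b \<in> Basis" and \<sigma>: "\<bar>\<sigma>\<bar> = 1"
    and y: "0 \<le> y" "y \<le> 1" and x: "\<alpha> \<le> x \<bullet> b" "x \<bullet> b \<le> \<alpha> + 1"
  shows "\<sigma> * (U (x, y) - U (reflection \<alpha> (b, 0) (x, y))) \<le> (c + N) * (x \<bullet> b - \<alpha>)"
proof -
  have b0: "(b, 0::real) \<in> Basis" using b by (simp add: Basis_prod_def)
  define r where "r = reflection \<alpha> (b, 0::real)"
  have r: "r p = (fst p + (2 * (\<alpha> - fst p \<bullet> b)) *\<^sub>R b, snd p)" for p
    by (simp add: r_def reflection_def prod_eq_iff inner_prod_def)
  define D where "D = {p :: 'a \<times> real. 0 \<le> snd p \<and> snd p \<le> 1 \<and> \<alpha> \<le> fst p \<bullet> b \<and> fst p \<bullet> b \<le> \<alpha> + 1}"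
  define D0 where "D0 = {p :: 'a \<times> real. 0 < snd p \<and> snd p < 1 \<and> \<alpha> < fst p \<bullet> b \<and> fst p \<bullet> b < \<alpha> + 1}"
  have D0: "D0 \<subseteq> interior D"
    unfolding D0_def by (intro interior_maximal open_Collect_conj open_Collect_less continuous_intros)
      (auto simp: D_def)
  define B where "B = (\<lambda>s. (c + N) * s - N * s\<^sup>2)"
  define w where "w = (\<lambda>p. ((- (c + N) * \<alpha> - N * \<alpha>\<^sup>2) + (c + N + 2 * N * \<alpha>) * (p \<bullet> (b, 0)) + (- N) * (p \<bullet> (b, 0))\<^sup>2)
     - \<sigma> * (U p - U (r p)))"
  have w: "w p = B (fst p \<bullet> b - \<alpha>) - \<sigma> * (U p - U (r p))" for p
    by (simp add: w_def B_def inner_prod_def algebra_simps power2_eq_square)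
  have bar: "0 \<le> B s" if "0 \<le> s" "s \<le> 1" for s
  proof -
    have "N * s\<^sup>2 \<le> N * s"
      using that N_nonneg by (intro mult_left_mono) (auto simp: power2_eq_square mult_left_le)
    moreover have "0 \<le> c * s" using that c_nonneg by simp
    ultimately show ?thesis by (simp add: B_def algebra_simps)
  qed
  have diff: "\<sigma> * (U p - U (r p)) \<le> c" if "p \<in> D" for p
  proof -
    have "0 \<le> U p \<and> U p \<le> c" "0 \<le> U (r p) \<and> U (r p) \<le> c"
      using bounds[of "snd p" "fst p"] bounds[of "snd p" "fst (r p)"] that by (auto simp: r D_def)
    then show ?thesis using \<sigma> by (auto simp: abs_if split: if_splits)
  qed
  have "w (x, y) \<ge> 0"
  proof (rule narrow_maximum_principle[of D 0 1 0 w c])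
    have "continuous_on D U"
      by (rule continuous_on_subset[OF cont]) (auto simp: D_def mem_Times_iff)
    moreover have "continuous_on D (\<lambda>p. U (r p))"
      by (rule continuous_on_compose2[OF cont]) (auto simp: r D_def intro!: continuous_intros)
    ultimately show "continuous_on D w"
      unfolding w_def by (intro continuous_intros)
  next
    fix p assume p: "p \<in> D"
    have "0 \<le> B (fst p \<bullet> b - \<alpha>)" by (rule bar) (use p in \<open>auto simp: D_def\<close>)
    then show "w p \<ge> - c"
      using diff[OF p] by (simp add: w)
  next
    fix p assume p: "p \<in> D" "w p < 0"
    have nn: "0 \<le> B (fst p \<bullet> b - \<alpha>)" by (rule bar) (use p in \<open>auto simp: D_def\<close>)
    have "U p \<noteq> U (r p)" using p nn by (auto simp: w)
    \<comment> \<open>The point and its mirror image have the same value on the hyperplane and on both boundary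
      components of the strip.\<close>
    then have ne: "snd p \<noteq> 0" "snd p \<noteq> 1" "fst p \<bullet> b \<noteq> \<alpha>"
      using bottom top by (auto simp: r) (metis prod.collapse)+
    have "B 1 = c" by (simp add: B_def)
    then have "fst p \<bullet> b - \<alpha> \<noteq> 1" using p(2) diff[OF p(1)] by (auto simp: w)
    with ne p have pD0: "p \<in> D0" by (auto simp: D0_def D_def)
    obtain l1 where l1: "has_lap U p l1" "\<bar>l1\<bar> \<le> N" using lap[of "snd p" "fst p"] pD0 by (auto simp: D0_def)
    obtain l2 where l2: "has_lap U (r p) l2" "\<bar>l2\<bar> \<le> N"
      using lap[of "snd p" "fst (r p)"] pD0 by (auto simp: D0_def r)
    have "has_lap w p (2 * (- N) - \<sigma> * (l1 - l2))" unfolding w_def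
      using l2(1) unfolding r_def
      by (intro has_lap_diff has_lap_cmult has_lap_quadratic_coordinate has_lap_reflection b0 l1)
    moreover have "2 * (- N) - \<sigma> * (l1 - l2) \<le> 0"
      using l1(2) l2(2) \<sigma> by (auto simp: abs_if split: if_splits)
    ultimately show "p \<in> interior D \<and> (\<exists>l. has_lap w p l \<and> l \<le> - 0 * w p)"
      using D0 pD0 by auto
  next
    show "closed D" unfolding D_def
      by (intro closed_Collect_conj closed_Collect_le continuous_intros)
  qed (use assms in \<open>auto simp: D_def mem_Times_iff\<close>)
  moreover have "0 \<le> N * (x \<bullet> b - \<alpha>)\<^sup>2" using N_nonneg by simp
  ultimately show ?thesis by (simp add: w B_def r_def)
qed

lemma lipschitz_horizontal:
  assumes b: "b \<in> Basis" and y: "0 \<le> y" "y \<le> 1"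
  shows "\<bar>U (x + t *\<^sub>R b, y) - U (x, y)\<bar> \<le> (c + N) * \<bar>t\<bar>"
proof -
  have nonneg: "\<bar>U (x + t *\<^sub>R b, y) - U (x, y)\<bar> \<le> (c + N) * t" if t: "0 \<le> t" for x t
  proof (cases "t \<le> 2")
    case True
    define \<alpha> where "\<alpha> = x \<bullet> b + t / 2"
    have r: "reflection \<alpha> (b, 0) (x + t *\<^sub>R b, y) = (x, y)"
      using b by (simp add: reflection_def \<alpha>_def inner_simps)
    have "\<sigma> * (U (x + t *\<^sub>R b, y) - U (x, y)) \<le> (c + N) * (t / 2)" if "\<bar>\<sigma>\<bar> = 1" for \<sigma>
      using reflection_estimate_horizontal[OF b that y, of \<alpha> "x + t *\<^sub>R b"] True t b
      unfolding r by (simp add: \<alpha>_def inner_simps)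
    from this[of 1] this[of "-1"]
    have "U (x + t *\<^sub>R b, y) - U (x, y) \<le> (c + N) * (t / 2)"
      "- (U (x + t *\<^sub>R b, y) - U (x, y)) \<le> (c + N) * (t / 2)" by auto
    then have "\<bar>U (x + t *\<^sub>R b, y) - U (x, y)\<bar> \<le> (c + N) * (t / 2)" by (rule abs_leI)
    also have "\<dots> \<le> (c + N) * t" using t c_nonneg N_nonneg by (intro mult_left_mono) auto
    finally show ?thesis .
  next
    case False
    have "\<bar>U (x + t *\<^sub>R b, y) - U (x, y)\<bar> \<le> c"
      using bounds[OF y, of x] bounds[OF y, of "x + t *\<^sub>R b"] by auto
    also have "\<dots> \<le> (c + N) * 1" using N_nonneg by simp
    also have "\<dots> \<le> (c + N) * t" using False c_nonneg N_nonneg by (intro mult_left_mono) auto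
    finally show ?thesis .
  qed
  show ?thesis
  proof (cases "0 \<le> t")
    case False
    then show ?thesis using nonneg[of "- t" "x + t *\<^sub>R b"] by (simp add: abs_minus_commute)
  qed (use nonneg in auto)
qed

text \<open>
  The same comparison for the reflection in \<open>y = a\<close>. It maps \<open>y = 0\<close> to \<open>y = 2 a\<close>, where the
  boundary estimate controls \<open>U\<close>; this is why \<open>a \<le> 1 / 2\<close>. The upper half of the strip is
  reached by flipping.
\<close>

lemma reflection_estimate_vertical:
  assumes \<sigma>: "\<bar>\<sigma>\<bar> = 1" and y: "0 \<le> y" "y \<le> a" and a: "a \<le> 1 / 2"
  shows "\<sigma> * (U (x, y) - U (x, 2 * a - y)) \<le> (2 * c + 2 * N) * (a - y)"
proof -
  have b0: "(0::'a, 1::real) \<in> Basis" by (simp add: Basis_prod_def)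
  define r where "r = reflection a (0::'a, 1::real)"
  have r: "r p = (fst p, 2 * a - snd p)" for p
    by (simp add: r_def reflection_def prod_eq_iff inner_prod_def)
  define D where "D = (UNIV :: 'a set) \<times> {0..a}"
  define A where "A = 2 * c + 2 * N"
  define B where "B = (\<lambda>s. A * s - N * s\<^sup>2)"
  define w where "w = (\<lambda>p. ((A * a - N * a\<^sup>2) + (2 * N * a - A) * (p \<bullet> (0, 1)) + (- N) * (p \<bullet> (0, 1))\<^sup>2)
     - \<sigma> * (U p - U (r p)))"
  have w: "w p = B (a - snd p) - \<sigma> * (U p - U (r p))" for p
    by (simp add: w_def B_def inner_prod_def algebra_simps power2_eq_square)
  have bar: "(2 * c + N) * s \<le> B s" if "0 \<le> s" "s \<le> 1" for s
  proof -
    have "N * s\<^sup>2 \<le> N * s"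
      using that N_nonneg by (intro mult_left_mono) (auto simp: power2_eq_square mult_left_le)
    then show ?thesis by (simp add: B_def A_def algebra_simps)
  qed
  have bar0: "0 \<le> B s" if "0 \<le> s" "s \<le> 1" for s
  proof -
    have "0 \<le> (2 * c + N) * s" using that N_nonneg c_nonneg by simp
    with bar[OF that] show ?thesis by simp
  qed
  have "w (x, y) \<ge> 0"
  proof (rule narrow_maximum_principle[of D 0 a 0 w c])
    have "continuous_on D U"
      by (rule continuous_on_subset[OF cont]) (use a in \<open>auto simp: D_def mem_Times_iff\<close>)
    moreover have "continuous_on D (\<lambda>p. U (r p))"
      by (rule continuous_on_compose2[OF cont]) (use a in \<open>auto simp: r D_def intro!: continuous_intros\<close>)
    ultimately show "continuous_on D w"
      unfolding w_def by (intro continuous_intros)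
  next
    fix p assume p: "p \<in> D"
    have "0 \<le> B (a - snd p)" by (rule bar0) (use p a in \<open>auto simp: D_def\<close>)
    moreover have "\<sigma> * (U p - U (r p)) \<le> c"
    proof -
      have "0 \<le> U p \<and> U p \<le> c" "0 \<le> U (r p) \<and> U (r p) \<le> c"
        using bounds[of "snd p" "fst p"] bounds[of "snd (r p)" "fst (r p)"] p a by (auto simp: r D_def)
      then show ?thesis using \<sigma> by (auto simp: abs_if split: if_splits)
    qed
    ultimately show "w p \<ge> - c" by (simp add: w)
  next
    fix p assume p: "p \<in> D" "w p < 0"
    have nn: "0 \<le> B (a - snd p)" by (rule bar0) (use p a in \<open>auto simp: D_def\<close>)
    have "U p \<noteq> U (r p)" using p nn by (auto simp: w)
    then have ne: "snd p \<noteq> a" by (auto simp: r)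
    have "snd p \<noteq> 0"
    proof
      assume p0: "snd p = 0"
      have a0: "0 \<le> a" using p by (auto simp: D_def)
      have "U (r p) \<le> (c + N / 2) * (2 * a)" "0 \<le> U (r p)"
        using boundary_estimate[of "2 * a" "fst p"] bounds[of "2 * a" "fst p"] a a0 by (auto simp: r p0)
      moreover have "U p = 0" using bottom[of "fst p"] p0 by (metis prod.collapse)
      ultimately have "\<sigma> * (U p - U (r p)) \<le> (2 * c + N) * a"
        using \<sigma> by (auto simp: abs_if algebra_simps split: if_splits)
      also have "\<dots> \<le> B (a - snd p)" using bar[of a] a a0 p0 by simp
      finally show False using p(2) by (simp add: w)
    qed
    then have yy: "0 < snd p" "snd p < a" using ne p by (auto simp: D_def)
    obtain l1 where l1: "has_lap U p l1" "\<bar>l1\<bar> \<le> N" using lap[of "snd p" "fst p"] yy a by auto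
    obtain l2 where l2: "has_lap U (r p) l2" "\<bar>l2\<bar> \<le> N"
      using lap[of "snd (r p)" "fst (r p)"] yy a by (auto simp: r)
    have "has_lap w p (2 * (- N) - \<sigma> * (l1 - l2))" unfolding w_def
      using l2(1) unfolding r_def
      by (intro has_lap_diff has_lap_cmult has_lap_quadratic_coordinate has_lap_reflection b0 l1)
    moreover have "2 * (- N) - \<sigma> * (l1 - l2) \<le> 0"
      using l1(2) l2(2) \<sigma> by (auto simp: abs_if split: if_splits)
    ultimately show "p \<in> interior D \<and> (\<exists>l. has_lap w p l \<and> l \<le> - 0 * w p)"
      using yy by (auto simp: D_def interior_Times mem_Times_iff)
  qed (use y in \<open>auto simp: D_def closed_Times\<close>)
  moreover have "0 \<le> N * (a - y)\<^sup>2" using N_nonneg by simp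
  ultimately show ?thesis by (simp add: w B_def r A_def)
qed

lemma flip: "bounded_strip_function (\<lambda>p. c - U (reflection (1/2) (0, 1) p)) N c"
proof -
  have r: "reflection (1/2) (0, 1) (x, y) = (x, 1 - y)" for x :: 'a and y :: real
    by (simp add: reflection_def)
  show ?thesis
  proof
    have "continuous_on (UNIV \<times> {0..1}) (\<lambda>p :: 'a \<times> real. U (reflection (1/2) (0, 1) p))"
      by (rule continuous_on_compose2[OF cont])
         (auto simp: r intro!: continuous_intros, auto simp: reflection_def intro!: continuous_intros)
    then show "continuous_on (UNIV \<times> {0..1}) (\<lambda>p. c - U (reflection (1/2) (0, 1) p))"
      by (intro continuous_intros)
  next
    fix x y assume y: "(0::real) < y" "y < 1"
    obtain l where l: "has_lap U (x, 1 - y) l" "\<bar>l\<bar> \<le> N" using lap[of "1 - y" x] y by auto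
    have c: "has_lap (\<lambda>p. c) (x, y) 0"
      using has_lap_quadratic_coordinate[of "(0, 1)" c 0 0 "(x, y)"] by (simp add: Basis_prod_def)
    have "has_lap (\<lambda>p. c - U (reflection (1/2) (0, 1) p)) (x, y) (0 - l)"
      by (rule has_lap_diff[OF c has_lap_reflection]) (simp_all add: r l Basis_prod_def)
    then show "\<exists>l. has_lap (\<lambda>p. c - U (reflection (1/2) (0, 1) p)) (x, y) l \<and> \<bar>l\<bar> \<le> N"
      using l(2) by (intro exI[of _ "0 - l"]) simp
  qed (use bounds bottom top in \<open>auto simp: r\<close>)
qed

lemma lipschitz_vertical_lower:
  assumes "0 \<le> y" "0 \<le> z" "y + z \<le> 1"
  shows "\<bar>U (x, y) - U (x, z)\<bar> \<le> (c + N) * \<bar>y - z\<bar>"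
proof -
  have *: "\<bar>U (x, y) - U (x, z)\<bar> \<le> (c + N) * (z - y)"
    if "0 \<le> y" "y \<le> z" "y + z \<le> 1" for y z
  proof -
    have mid: "2 * ((y + z) / 2) - y = z" "(2 * c + 2 * N) * ((y + z) / 2 - y) = (c + N) * (z - y)"
      by (simp_all add: field_simps)
    have "\<sigma> * (U (x, y) - U (x, z)) \<le> (c + N) * (z - y)" if "\<bar>\<sigma>\<bar> = 1" for \<sigma>
      using reflection_estimate_vertical[OF that, of y "(y + z) / 2" x] \<open>0 \<le> y\<close> \<open>y \<le> z\<close> \<open>y + z \<le> 1\<close>
      unfolding mid by simp
    from this[of 1, simplified] this[of "-1", simplified] show ?thesis
      by (simp add: abs_le_iff)
  qed
  show ?thesis
    using *[of y z] *[of z y] assms by (cases "y \<le> z") (auto simp: abs_minus_commute)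
qed

lemma lipschitz_vertical:
  assumes "0 \<le> y" "y \<le> 1" "0 \<le> z" "z \<le> 1"
  shows "\<bar>U (x, y) - U (x, z)\<bar> \<le> (c + N) * \<bar>y - z\<bar>"
proof (cases "y + z \<le> 1")
  case True
  then show ?thesis using assms lipschitz_vertical_lower by auto
next
  case False
  interpret f: bounded_strip_function "\<lambda>p. c - U (reflection (1/2) (0, 1) p)" N c by (rule flip)
  have "\<bar>U (x, z) - U (x, y)\<bar> \<le> (c + N) * \<bar>z - y\<bar>"
    using f.lipschitz_vertical_lower[of "1 - y" "1 - z" x] assms False
    by (simp add: reflection_def)
  then show ?thesis by (simp add: abs_minus_commute)
qed

lemma lipschitz:
  assumes "p \<in> UNIV \<times> {0..1}" "q \<in> UNIV \<times> {0..1}"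
  shows "\<bar>U p - U q\<bar> \<le> (c + N) * (real DIM('a) + 1) * dist p q"
proof -
  obtain x y x' y' where pq: "p = (x, y)" "q = (x', y')" by (cases p; cases q)
  have y: "0 \<le> y" "y \<le> 1" "0 \<le> y'" "y' \<le> 1" using assms pq by auto
  have cN: "0 \<le> c + N" using c_nonneg N_nonneg by simp
  define h where "h = x - x'"
  have "\<bar>U (x' + (\<Sum>b\<in>I. (h \<bullet> b) *\<^sub>R b), y) - U (x', y)\<bar> \<le> (c + N) * (\<Sum>b\<in>I. \<bar>h \<bullet> b\<bar>)"
    if "finite I" "I \<subseteq> Basis" for I
    using that
  proof (induction I)
    case (insert b I)
    define z where "z = x' + (\<Sum>b\<in>I. (h \<bullet> b) *\<^sub>R b)"
    have "\<bar>U (z + (h \<bullet> b) *\<^sub>R b, y) - U (z, y)\<bar> \<le> (c + N) * \<bar>h \<bullet> b\<bar>"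
      using insert by (intro lipschitz_horizontal y) auto
    moreover have "x' + (\<Sum>b\<in>insert b I. (h \<bullet> b) *\<^sub>R b) = z + (h \<bullet> b) *\<^sub>R b"
      using insert by (simp add: z_def)
    moreover have "\<bar>U (z, y) - U (x', y)\<bar> \<le> (c + N) * (\<Sum>b\<in>I. \<bar>h \<bullet> b\<bar>)"
      using insert by (simp add: z_def)
    moreover have "(c + N) * (\<Sum>b\<in>insert b I. \<bar>h \<bullet> b\<bar>) = (c + N) * \<bar>h \<bullet> b\<bar> + (c + N) * (\<Sum>b\<in>I. \<bar>h \<bullet> b\<bar>)"
      using insert by (simp add: distrib_left)
    ultimately show ?case by simp
  qed simp
  from this[of Basis] have "\<bar>U (x, y) - U (x', y)\<bar> \<le> (c + N) * (\<Sum>b\<in>Basis. \<bar>h \<bullet> b\<bar>)"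
    by (simp add: euclidean_representation h_def)
  also have "\<dots> \<le> (c + N) * (\<Sum>b\<in>(Basis::'a set). dist p q)"
  proof (intro mult_left_mono sum_mono cN)
    fix b :: 'a assume "b \<in> Basis"
    then have "\<bar>h \<bullet> b\<bar> \<le> norm h" by (rule Basis_le_norm)
    also have "\<dots> \<le> dist p q" using dist_fst_le[of p q] by (simp add: pq h_def dist_norm)
    finally show "\<bar>h \<bullet> b\<bar> \<le> dist p q" .
  qed
  finally have 1: "\<bar>U (x, y) - U (x', y)\<bar> \<le> (c + N) * (real DIM('a) * dist p q)" by simp
  have "\<bar>U (x', y) - U (x', y')\<bar> \<le> (c + N) * \<bar>y - y'\<bar>" by (rule lipschitz_vertical) (use y in auto)
  also have "\<dots> \<le> (c + N) * dist p q"
    using dist_snd_le[of p q] cN by (intro mult_left_mono) (auto simp: pq dist_real_def)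
  finally show ?thesis using 1 by (simp add: pq algebra_simps)
qed

end

section \<open>Quantitative strong maximum principle\<close>

text \<open>
  For large \<open>\<alpha>\<close> the Laplacian of the Gaussian is a large multiple of the Gaussian away from its centre,
  so that it is a strict subsolution of \<open>\<Delta>w = L w\<close> there.
\<close>

lemma has_lap_gaussian:
  fixes p x :: "'a::euclidean_space"
  shows "has_lap (\<lambda>x. exp (- \<alpha> * (dist x p)\<^sup>2)) x
    ((4 * \<alpha>\<^sup>2 * (dist x p)\<^sup>2 - 2 * \<alpha> * real DIM('a)) * exp (- \<alpha> * (dist x p)\<^sup>2))"
proof -
  define E where "E = exp (- \<alpha> * (dist x p)\<^sup>2)"
  define s where "s = (\<lambda>b. (x - p) \<bullet> b)"
  have d2: "(dist x p)\<^sup>2 = (x - p) \<bullet> (x - p)" by (simp add: dist_norm dot_square_norm)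
  have "has_deriv2 (\<lambda>t. exp (- \<alpha> * (dist (x + t *\<^sub>R b) p)\<^sup>2)) ((4 * \<alpha>\<^sup>2 * (s b)\<^sup>2 - 2 * \<alpha>) * E)"
    if b: "b \<in> Basis" for b
  proof -
    define g where "g = (\<lambda>t. exp (- \<alpha> * ((dist x p)\<^sup>2 + 2 * t * s b + t\<^sup>2)))"
    have eq: "exp (- \<alpha> * (dist (x + t *\<^sub>R b) p)\<^sup>2) = g t" for t
    proof -
      have "x + t *\<^sub>R b - p = (x - p) + t *\<^sub>R b" by simp
      then have "(dist (x + t *\<^sub>R b) p)\<^sup>2 = ((x - p) + t *\<^sub>R b) \<bullet> ((x - p) + t *\<^sub>R b)"
        by (simp only: dist_norm power2_norm_eq_inner)
      also have "\<dots> = (dist x p)\<^sup>2 + 2 * t * s b + t\<^sup>2"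
        unfolding d2 s_def inner_add_left inner_add_right inner_scaleR_left inner_scaleR_right
        using b by (simp add: inner_commute[of b "x - p"] power2_eq_square distrib_left)
      finally show ?thesis by (simp add: g_def)
    qed
    have g': "(g has_real_derivative (- \<alpha> * (2 * s b + 2 * t)) * g t) (at t)" for t
      unfolding g_def by (auto intro!: derivative_eq_intros)
    have "((\<lambda>t. - \<alpha> * (2 * s b + 2 * t)) has_real_derivative - \<alpha> * 2) (at 0)"
      by (auto intro!: derivative_eq_intros)
    from DERIV_mult[OF this g'[of 0]]
    have "((\<lambda>t. (- \<alpha> * (2 * s b + 2 * t)) * g t) has_real_derivative
      (- \<alpha> * 2) * g 0 + ((- \<alpha> * (2 * s b + 2 * 0)) * g 0) * (- \<alpha> * (2 * s b + 2 * 0))) (at 0)" .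
    moreover have "(- \<alpha> * 2) * g 0 + ((- \<alpha> * (2 * s b + 2 * 0)) * g 0) * (- \<alpha> * (2 * s b + 2 * 0))
      = (4 * \<alpha>\<^sup>2 * (s b)\<^sup>2 - 2 * \<alpha>) * E"
      by (simp add: g_def E_def algebra_simps power2_eq_square)
    ultimately have "((\<lambda>t. (- \<alpha> * (2 * s b + 2 * t)) * g t) has_real_derivative
      (4 * \<alpha>\<^sup>2 * (s b)\<^sup>2 - 2 * \<alpha>) * E) (at 0)" by metis
    then show ?thesis unfolding eq
      by (intro has_deriv2I[where g' = "\<lambda>t. (- \<alpha> * (2 * s b + 2 * t)) * g t"] always_eventually allI g')
  qed
  then have "\<forall>b\<in>Basis. has_deriv2 (\<lambda>t. exp (- \<alpha> * (dist (x + t *\<^sub>R b) p)\<^sup>2)) ((4 * \<alpha>\<^sup>2 * (s b)\<^sup>2 - 2 * \<alpha>) * E)"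
    by blast
  moreover have "(4 * \<alpha>\<^sup>2 * (dist x p)\<^sup>2 - 2 * \<alpha> * real DIM('a)) * E
      = (\<Sum>b\<in>Basis. (4 * \<alpha>\<^sup>2 * (s b)\<^sup>2 - 2 * \<alpha>) * E)"
  proof -
    have "(dist x p)\<^sup>2 = (\<Sum>b\<in>Basis. (s b)\<^sup>2)"
      unfolding d2 s_def by (subst euclidean_inner) (simp add: power2_eq_square)
    then show ?thesis
      by (simp only: sum_distrib_right[symmetric] sum_subtractf sum_distrib_left[symmetric]) simp
  qed
  ultimately show ?thesis unfolding has_lap_def E_def[symmetric]
    by (intro exI[of _ "\<lambda>b. (4 * \<alpha>\<^sup>2 * (s b)\<^sup>2 - 2 * \<alpha>) * E"] conjI)
qed

text \<open>
  Compare \<open>w\<close> with the Gaussian, shifted to vanish on the outer sphere, in the annulus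
  between the radii \<open>r\<close> and \<open>R\<close> (Hopf's barrier). If the difference were negative at an interior
  minimum, the subsolution property of the Gaussian would make its Laplacian negative.
\<close>

lemma annulus_comparison:
  fixes w :: "'a::euclidean_space \<Rightarrow> real"
  assumes r: "0 < r" and \<alpha>: "0 < \<alpha>" "L < 4 * \<alpha>\<^sup>2 * r\<^sup>2 - 2 * \<alpha> * real DIM('a)"
    and L: "0 \<le> L" and m: "0 < m"
    and cont: "continuous_on (cball p R) w"
    and nonneg: "\<And>x. x \<in> cball p R \<Longrightarrow> 0 \<le> w x"
    and inner: "\<And>x. x \<in> cball p r \<Longrightarrow> m \<le> w x"
    and super: "\<And>x. x \<in> ball p R \<Longrightarrow> \<exists>l. has_lap w x l \<and> l \<le> L * w x"
    and x: "x \<in> cball p R"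
  shows "m * (exp (- \<alpha> * (dist x p)\<^sup>2) - exp (- \<alpha> * R\<^sup>2)) \<le> w x"
proof -
  define E where "E = (\<lambda>x. exp (- \<alpha> * (dist x p)\<^sup>2))"
  define ER where "ER = exp (- \<alpha> * R\<^sup>2)"
  define v where "v = (\<lambda>x. w x - m * (E x - ER))"
  have E: "0 < E x" "E x \<le> 1" for x using \<alpha> by (auto simp: E_def)
  have ER: "0 < ER" by (simp add: ER_def)
  have v_inner: "0 \<le> v x" if "dist p x \<le> r" for x
  proof -
    have "m * (E x - ER) \<le> m * 1" using E[of x] ER m by (intro mult_left_mono) auto
    then show ?thesis using inner[of x] that by (simp add: v_def)
  qed
  define A where "A = cball p R - ball p r"
  have "0 \<le> v x"
  proof (rule ccontr)
    assume neg: "\<not> 0 \<le> v x"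
    then have xA: "x \<in> A" using x v_inner[of x] by (auto simp: A_def)
    have "compact A" unfolding A_def by (intro compact_diff compact_cball open_ball)
    moreover have "continuous_on A v"
      unfolding v_def E_def by (intro continuous_intros continuous_on_subset[OF cont]) (auto simp: A_def)
    ultimately obtain z where z: "z \<in> A" "\<And>y. y \<in> A \<Longrightarrow> v z \<le> v y"
      using continuous_attains_inf[of A v] xA by blast
    have vz: "v z < 0" using z(2)[OF xA] neg by simp
    have zr: "r < dist p z" using v_inner[of z] vz by linarith
    have "dist p z \<noteq> R"
    proof
      assume "dist p z = R"
      then have "E z = ER" by (simp add: E_def ER_def dist_commute)
      then show False using nonneg[of z] z(1) vz by (auto simp: v_def A_def)
    qed
    then have zR: "dist p z < R" using z(1) by (auto simp: A_def)
    obtain l where l: "has_lap w z l" "l \<le> L * w z" using super[of z] zR by auto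
    define k where "k = 4 * \<alpha>\<^sup>2 * (dist z p)\<^sup>2 - 2 * \<alpha> * real DIM('a)"
    have "4 * \<alpha>\<^sup>2 * r\<^sup>2 \<le> 4 * \<alpha>\<^sup>2 * (dist z p)\<^sup>2"
      using zr r \<alpha> by (intro mult_left_mono power_mono) (auto simp: dist_commute)
    then have k: "L < k" using \<alpha>(2) by (simp add: k_def)
    have c: "has_lap (\<lambda>x. ER) z 0"
      using has_lap_quadratic_coordinate[of "SOME b. b \<in> Basis" ER 0 0 z] by (simp add: some_in_eq)
    have "has_lap v z (l - m * (k * E z - 0))"
      unfolding v_def E_def k_def
      by (intro has_lap_diff has_lap_cmult has_lap_gaussian l c)
    moreover have "\<forall>\<^sub>F y in nhds z. v z \<le> v y"
    proof (rule eventually_mono)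
      have "open (ball p R - cball p r)" by (intro open_Diff open_ball closed_cball)
      then show "\<forall>\<^sub>F y in nhds z. y \<in> ball p R - cball p r"
        by (rule eventually_nhds_in_open) (use zr zR in auto)
    qed (use z(2) in \<open>auto simp: A_def\<close>)
    ultimately have "0 \<le> l - m * (k * E z - 0)" by (rule has_lap_local_min)
    then have "m * k * E z \<le> L * w z" using l(2) by simp
    also have "\<dots> \<le> L * (m * (E z - ER))" using vz L by (intro mult_left_mono) (auto simp: v_def)
    also have "\<dots> \<le> L * (m * E z)" using ER m L by (intro mult_left_mono) auto
    finally have "(k - L) * (m * E z) \<le> 0" by (simp add: algebra_simps)
    moreover have "0 < (k - L) * (m * E z)" using k m E by simp
    ultimately show False by simp
  qed
  then show ?thesis by (simp add: v_def E_def ER_def)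
qed

text \<open>
  The point of this form is uniformity: \<open>\<kappa>\<close> depends only on the radii and on \<open>L\<close>, and so the
  estimate can replace a compactness argument on an unbounded domain.
\<close>

lemma positivity_spreads_to_half_ball:
  fixes L r R :: real
  assumes "0 \<le> L" "0 < r" "0 < R"
  shows "\<exists>\<kappa>>0. \<forall>(w :: 'a::euclidean_space \<Rightarrow> real) p m. 0 < m \<longrightarrow> continuous_on (cball p R) w \<longrightarrow>
    (\<forall>x\<in>cball p R. 0 \<le> w x) \<longrightarrow> (\<forall>x\<in>cball p r. m \<le> w x) \<longrightarrow>
    (\<forall>x\<in>ball p R. \<exists>l. has_lap w x l \<and> l \<le> L * w x) \<longrightarrow> (\<forall>x\<in>cball p (R / 2). \<kappa> * m \<le> w x)"
proof -
  define n where "n = real DIM('a)"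
  \<comment> \<open>Then \<open>4 \<alpha>\<^sup>2 r\<^sup>2 - 2 \<alpha> n \<ge> 2 \<alpha> (L + 1) > L\<close>.\<close>
  define \<alpha> where "\<alpha> = max 1 ((n + L + 1) / (2 * r\<^sup>2))"
  have \<alpha>: "1 \<le> \<alpha>" "n + L + 1 \<le> 2 * \<alpha> * r\<^sup>2"
    using assms(2) by (auto simp: \<alpha>_def max_def field_simps)
  have "L < 2 * (L + 1)" using assms by simp
  also have "\<dots> \<le> 2 * \<alpha> * (L + 1)" using \<alpha> assms by (intro mult_right_mono) auto
  also have "\<dots> \<le> 2 * \<alpha> * (2 * \<alpha> * r\<^sup>2 - n)" using \<alpha> by (intro mult_left_mono) auto
  finally have \<alpha>L: "L < 4 * \<alpha>\<^sup>2 * r\<^sup>2 - 2 * \<alpha> * n" by (simp add: algebra_simps power2_eq_square)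
  define \<kappa> where "\<kappa> = exp (- \<alpha> * (R / 2)\<^sup>2) - exp (- \<alpha> * R\<^sup>2)"
  show ?thesis
  proof (intro exI[of _ \<kappa>] conjI allI impI ballI)
    have "(R / 2)\<^sup>2 < R\<^sup>2" using assms by (intro power_strict_mono) auto
    then show "0 < \<kappa>" using \<alpha> by (simp add: \<kappa>_def)
  next
    fix w :: "'a \<Rightarrow> real" and p x :: 'a and m :: real
    assume h: "0 < m" "continuous_on (cball p R) w" "\<forall>x\<in>cball p R. 0 \<le> w x" "\<forall>x\<in>cball p r. m \<le> w x"
      "\<forall>x\<in>ball p R. \<exists>l. has_lap w x l \<and> l \<le> L * w x" and x: "x \<in> cball p (R / 2)"
    have "\<kappa> * m \<le> m * (exp (- \<alpha> * (dist x p)\<^sup>2) - exp (- \<alpha> * R\<^sup>2))"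
    proof -
      have "(dist x p)\<^sup>2 \<le> (R / 2)\<^sup>2" using x by (intro power_mono) (auto simp: dist_commute)
      then have "exp (- \<alpha> * (R / 2)\<^sup>2) \<le> exp (- \<alpha> * (dist x p)\<^sup>2)" using \<alpha> by simp
      then show ?thesis using h(1) by (simp add: \<kappa>_def mult.commute)
    qed
    also have "\<dots> \<le> w x"
      by (rule annulus_comparison[of r \<alpha> L]) (use h x assms \<alpha> \<alpha>L in \<open>auto simp: n_def\<close>)
    finally show "\<kappa> * m \<le> w x" .
  qed
qed

text \<open>
  A Lipschitz function that is at least \<open>m\<close> at a point is at least \<open>m / 2\<close> on a ball whose radius does
  not depend on the point; from there positivity spreads to a ball of radius \<open>R / 2\<close>. Any two
  points of the convex set \<open>S\<close> at distance at most \<open>\<rho>\<close> are joined by a bounded number of such steps, so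
  the bound \<open>\<kappa>\<close> is uniform over \<open>S\<close> even if \<open>S\<close> is unbounded.
\<close>

lemma propagation_of_positivity:
  fixes w :: "'a::euclidean_space \<Rightarrow> real"
  assumes R: "0 < R" and L: "0 \<le> L" and K: "0 \<le> K" and S: "convex S"
    and balls: "\<And>p. p \<in> S \<Longrightarrow> cball p R \<subseteq> \<Omega>"
    and nonneg: "\<And>x. x \<in> \<Omega> \<Longrightarrow> 0 \<le> w x"
    and lip: "\<And>x y. x \<in> \<Omega> \<Longrightarrow> y \<in> \<Omega> \<Longrightarrow> \<bar>w x - w y\<bar> \<le> K * dist x y"
    and super: "\<And>x. x \<in> \<Omega> \<Longrightarrow> \<exists>l. has_lap w x l \<and> l \<le> L * w x"
    and m: "0 < m"
  shows "\<exists>\<kappa>>0. \<forall>p\<in>S. \<forall>q\<in>S. dist p q \<le> \<rho> \<longrightarrow> m \<le> w p \<longrightarrow> \<kappa> \<le> w q"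
proof -
  have step: "\<exists>\<kappa>>0. \<forall>p\<in>S. m \<le> w p \<longrightarrow> (\<forall>x\<in>cball p (R / 2). \<kappa> \<le> w x)" if m: "0 < m" for m
  proof -
    define r where "r = min R (m / (2 * (K + 1)))"
    have r: "0 < r" "r \<le> R" using R K m by (auto simp: r_def)
    have "K * r \<le> K * (m / (2 * (K + 1)))" using K by (intro mult_left_mono) (auto simp: r_def)
    also have "\<dots> \<le> m / 2" using K m by (simp add: field_simps)
    finally have Kr: "K * r \<le> m / 2" .
    from positivity_spreads_to_half_ball[OF L r(1) R] obtain \<kappa> where "0 < \<kappa>"
      and \<kappa>: "\<forall>(w :: 'a \<Rightarrow> real) p m. 0 < m \<longrightarrow> continuous_on (cball p R) w \<longrightarrow>
        (\<forall>x\<in>cball p R. 0 \<le> w x) \<longrightarrow> (\<forall>x\<in>cball p r. m \<le> w x) \<longrightarrow>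
        (\<forall>x\<in>ball p R. \<exists>l. has_lap w x l \<and> l \<le> L * w x) \<longrightarrow> (\<forall>x\<in>cball p (R / 2). \<kappa> * m \<le> w x)"
      by (elim exE conjE) (rule that)
    have "\<forall>x\<in>cball p (R / 2). \<kappa> * (m / 2) \<le> w x" if p: "p \<in> S" "m \<le> w p" for p
    proof (rule \<kappa>[THEN spec, THEN spec, THEN spec, THEN mp, THEN mp, THEN mp, THEN mp, THEN mp])
      have p\<Omega>: "p \<in> \<Omega>" using balls[OF p(1)] R by auto
      have "K-lipschitz_on (cball p R) w"
        by (rule lipschitz_onI) (use lip subsetD[OF balls[OF p(1)]] K in \<open>auto simp: dist_real_def\<close>)
      then show "continuous_on (cball p R) w" by (rule lipschitz_on_continuous_on)
      show "\<forall>x\<in>cball p r. m / 2 \<le> w x"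
      proof
        fix x assume x: "x \<in> cball p r"
        then have "x \<in> \<Omega>" using balls[OF p(1)] r by auto
        with lip[OF p\<Omega> this] have "w p - w x \<le> K * dist p x" by auto
        also have "\<dots> \<le> K * r" using x K by (intro mult_left_mono) auto
        finally show "m / 2 \<le> w x" using Kr p(2) by simp
      qed
      show "\<forall>x\<in>cball p R. 0 \<le> w x" using nonneg balls[OF p(1)] by auto
      have "ball p R \<subseteq> \<Omega>" using balls[OF p(1)] ball_subset_cball by blast
      then show "\<forall>x\<in>ball p R. \<exists>l. has_lap w x l \<and> l \<le> L * w x" using super by blast
    qed (use m in simp)
    then show ?thesis using \<open>0 < \<kappa>\<close> m by (intro exI[of _ "\<kappa> * (m / 2)"]) auto
  qed
  have chain: "\<exists>\<kappa>>0. \<forall>p\<in>S. \<forall>q\<in>S. dist p q \<le> real k * (R / 2) \<longrightarrow> m \<le> w p \<longrightarrow> \<kappa> \<le> w q"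
    if "0 < m" for m and k :: nat
    using that
  proof (induction k arbitrary: m)
    case 0
    then show ?case by (intro exI[of _ m]) auto
  next
    case (Suc k)
    obtain \<kappa>1 where \<kappa>1: "0 < \<kappa>1" "\<And>p x. p \<in> S \<Longrightarrow> m \<le> w p \<Longrightarrow> x \<in> cball p (R / 2) \<Longrightarrow> \<kappa>1 \<le> w x"
      using step[OF Suc.prems] by blast
    obtain \<kappa> where \<kappa>: "0 < \<kappa>"
      "\<And>p q. p \<in> S \<Longrightarrow> q \<in> S \<Longrightarrow> dist p q \<le> real k * (R / 2) \<Longrightarrow> \<kappa>1 \<le> w p \<Longrightarrow> \<kappa> \<le> w q"
      using Suc.IH[OF \<kappa>1(1)] by blast
    show ?case
    proof (intro exI[of _ \<kappa>] conjI ballI impI \<kappa>(1))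
      fix p q assume pq: "p \<in> S" "q \<in> S" "dist p q \<le> real (Suc k) * (R / 2)" "m \<le> w p"
      \<comment> \<open>The first of \<open>k + 1\<close> equal steps along the segment from \<open>p\<close> to \<open>q\<close>.\<close>
      define s where "s = 1 / real (Suc k)"
      define z where "z = p + s *\<^sub>R (q - p)"
      have s: "0 \<le> s" "s \<le> 1" by (auto simp: s_def)
      have "z = (1 - s) *\<^sub>R p + s *\<^sub>R q" by (simp add: z_def algebra_simps)
      then have zS: "z \<in> S" using convexD_alt[OF S pq(1,2) s] by simp
      have "dist p z = s * dist p q" using s by (simp add: z_def dist_norm norm_minus_commute)
      also have "\<dots> \<le> s * (real (Suc k) * (R / 2))" using s pq by (intro mult_left_mono)
      also have "\<dots> = R / 2" by (simp add: s_def)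
      finally have "\<kappa>1 \<le> w z" using \<kappa>1(2)[OF pq(1,4), of z] by simp
      moreover have "dist z q \<le> real k * (R / 2)"
      proof -
        have "z - q = (1 - s) *\<^sub>R (p - q)" by (simp add: z_def algebra_simps)
        then have "dist z q = (1 - s) * dist p q" using s by (simp add: dist_norm)
        also have "\<dots> \<le> (1 - s) * (real (Suc k) * (R / 2))" using s pq by (intro mult_left_mono) auto
        also have "\<dots> = real k * (R / 2)" by (simp add: s_def field_simps)
        finally show ?thesis .
      qed
      ultimately show "\<kappa> \<le> w q" using \<kappa>(2)[OF zS pq(2)] by blast
    qed
  qed
  obtain k :: nat where k: "\<rho> < real k * (R / 2)"
    using reals_Archimedean3[of "R / 2"] R by auto
  obtain \<kappa> where "0 < \<kappa>"
    and \<kappa>: "\<And>p q. p \<in> S \<Longrightarrow> q \<in> S \<Longrightarrow> dist p q \<le> real k * (R / 2) \<Longrightarrow> m \<le> w p \<Longrightarrow> \<kappa> \<le> w q"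
    using chain[OF m, of k] by blast
  show ?thesis
    by (intro exI[of _ \<kappa>] conjI ballI impI \<open>0 < \<kappa>\<close> \<kappa>) (use k in auto)
qed

section \<open>The sliding method\<close>

locale monotone_strip_solution = bounded_strip_function U N c
  for U :: "'a::euclidean_space \<times> real \<Rightarrow> real" and N c :: real +
  fixes f :: "real \<Rightarrow> real" and L :: real
  assumes c_pos: "0 < c"
    and mono: "\<And>x y z. 0 \<le> y \<Longrightarrow> y \<le> z \<Longrightarrow> z \<le> 1 \<Longrightarrow> U (x, y) \<le> U (x, z)"
    and equation: "\<And>x y. 0 < y \<Longrightarrow> y < 1 \<Longrightarrow> has_lap U (x, y) (- f (U (x, y)))"
    and f_lipschitz: "L-lipschitz_on {0..c} f"
begin

lemma L_nonneg: "0 \<le> L"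
  using f_lipschitz by (rule lipschitz_on_nonneg)

definition K :: real where "K = (c + N) * (real DIM('a) + 1)"

lemma K_nonneg: "0 \<le> K"
  using c_nonneg N_nonneg by (simp add: K_def)

lemma U_lipschitz:
  assumes "p \<in> UNIV \<times> {0..1}" "q \<in> UNIV \<times> {0..1}"
  shows "\<bar>U p - U q\<bar> \<le> K * dist p q"
  using lipschitz[OF assms] by (simp add: K_def)

text \<open>
  The difference between \<open>U\<close> shifted down by \<open>\<tau>\<close> (and horizontally by \<open>\<xi>\<close>) and \<open>U\<close> itself. It lives
  on the strip \<open>0 \<le> y \<le> 1 - \<tau>\<close>, and the Lipschitz bound on \<open>f\<close> turns the two equations into
  \<open>|\<Delta>(gap)| \<le> L |gap|\<close>.
\<close>

definition gap :: "'a \<Rightarrow> real \<Rightarrow> 'a \<times> real \<Rightarrow> real"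
  where "gap \<xi> \<tau> p = U (p + (\<xi>, \<tau>)) - U p"

lemma has_lap_gap:
  assumes "0 < y" "0 \<le> \<tau>" "y + \<tau> < 1"
  shows "\<exists>l. has_lap (gap \<xi> \<tau>) (x, y) l \<and> \<bar>l\<bar> \<le> L * \<bar>gap \<xi> \<tau> (x, y)\<bar>"
proof (intro exI conjI)
  have "has_lap (\<lambda>p. U (p + (\<xi>, \<tau>))) (x, y) (- f (U (x + \<xi>, y + \<tau>)))"
    by (rule has_lap_translate) (use equation assms in simp)
  then show "has_lap (gap \<xi> \<tau>) (x, y) (- f (U (x + \<xi>, y + \<tau>)) - (- f (U (x, y))))"
    unfolding gap_def using assms by (intro has_lap_diff equation) auto
  show "\<bar>- f (U (x + \<xi>, y + \<tau>)) - (- f (U (x, y)))\<bar> \<le> L * \<bar>gap \<xi> \<tau> (x, y)\<bar>"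
    using lipschitz_onD[OF f_lipschitz, of "U (x + \<xi>, y + \<tau>)" "U (x, y)"]
      bounds[of "y + \<tau>" "x + \<xi>"] bounds[of y x] assms
    by (simp add: gap_def dist_real_def abs_minus_commute)
qed

lemma continuous_on_gap:
  assumes "0 \<le> a" "0 \<le> \<tau>" "b + \<tau> \<le> 1"
  shows "continuous_on (UNIV \<times> {a..b}) (gap \<xi> \<tau>)"
proof -
  have "continuous_on (UNIV \<times> {a..b}) (\<lambda>p. U (p + (\<xi>, \<tau>)))"
    by (rule continuous_on_compose2[OF cont]) (use assms in \<open>auto intro!: continuous_intros\<close>)
  moreover have "continuous_on (UNIV \<times> {a..b}) U"
    by (rule continuous_on_subset[OF cont]) (use assms in auto)
  ultimately show ?thesis unfolding gap_def by (rule continuous_on_diff)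
qed

lemma gap_nonneg_on_narrow_strip:
  assumes ab: "0 \<le> a" "0 \<le> \<tau>" "b + \<tau> \<le> 1" "L * (b - a)\<^sup>2 < 2"
    and bdry: "\<And>x. 0 \<le> gap \<xi> \<tau> (x, a)" "\<And>x. 0 \<le> gap \<xi> \<tau> (x, b)"
    and y: "a \<le> y" "y \<le> b"
  shows "0 \<le> gap \<xi> \<tau> (x, y)"
proof (rule narrow_maximum_principle[of "UNIV \<times> {a..b}" a "b - a" L "gap \<xi> \<tau>" c])
  show "continuous_on (UNIV \<times> {a..b}) (gap \<xi> \<tau>)" by (rule continuous_on_gap) (use ab in auto)
next
  fix p :: "'a \<times> real" assume "p \<in> UNIV \<times> {a..b}"
  then show "- c \<le> gap \<xi> \<tau> p"
    using bounds[of "snd p" "fst p"] bounds[of "snd p + \<tau>" "fst p + \<xi>"] ab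
    by (cases p) (auto simp: gap_def)
next
  fix p :: "'a \<times> real" assume p: "p \<in> UNIV \<times> {a..b}" "gap \<xi> \<tau> p < 0"
  obtain x y where xy: "p = (x, y)" by (cases p)
  have y: "a < y" "y < b" using p bdry[of x] by (auto simp: xy less_le)
  obtain l where "has_lap (gap \<xi> \<tau>) p l" "\<bar>l\<bar> \<le> L * \<bar>gap \<xi> \<tau> p\<bar>"
    using has_lap_gap[of y \<tau> \<xi> x] y ab xy by auto
  moreover from this p(2) have "l \<le> - L * gap \<xi> \<tau> p" by (simp add: abs_le_iff)
  ultimately show "p \<in> interior (UNIV \<times> {a..b}) \<and> (\<exists>l. has_lap (gap \<xi> \<tau>) p l \<and> l \<le> - L * gap \<xi> \<tau> p)"
    using y by (auto simp: xy interior_Times)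
qed (use assms L_nonneg in \<open>auto simp: closed_Times\<close>)

text \<open>
  The horizontal shift \<open>\<xi>\<close> stays fixed while the vertical shift \<open>\<tau>\<close> decreases from near 1 to 0.
\<close>

definition slid_above :: "'a \<Rightarrow> real \<Rightarrow> bool"
  where "slid_above \<xi> \<tau> \<longleftrightarrow> (\<forall>x y. 0 \<le> y \<longrightarrow> y + \<tau> \<le> 1 \<longrightarrow> 0 \<le> gap \<xi> \<tau> (x, y))"

lemma gap_bottom_nonneg: "0 \<le> \<tau> \<Longrightarrow> \<tau> \<le> 1 \<Longrightarrow> 0 \<le> gap \<xi> \<tau> (x, 0)"
  using bounds[of \<tau> "x + \<xi>"] by (simp add: gap_def bottom)

lemma gap_top_nonneg: "0 \<le> \<tau> \<Longrightarrow> \<tau> \<le> 1 \<Longrightarrow> 0 \<le> gap \<xi> \<tau> (x, 1 - \<tau>)"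
  using bounds[of "1 - \<tau>" x] by (simp add: gap_def top)

lemma gap_lipschitz:
  assumes "0 \<le> \<tau>" "p \<in> UNIV \<times> {0..1-\<tau>}" "q \<in> UNIV \<times> {0..1-\<tau>}"
  shows "\<bar>gap \<xi> \<tau> p - gap \<xi> \<tau> q\<bar> \<le> 2 * K * dist p q"
proof -
  have "\<bar>U (p + (\<xi>, \<tau>)) - U (q + (\<xi>, \<tau>))\<bar> \<le> K * dist (p + (\<xi>, \<tau>)) (q + (\<xi>, \<tau>))"
    by (rule U_lipschitz) (use assms in \<open>auto simp: mem_Times_iff\<close>)
  moreover have "\<bar>U p - U q\<bar> \<le> K * dist p q"
    by (rule U_lipschitz) (use assms in \<open>auto simp: mem_Times_iff\<close>)
  ultimately show ?thesis by (simp add: gap_def)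
qed

text \<open>
  This is where an unbounded domain could let the infimum be \<open>0\<close> without being attained. Suppose
  that the gap is tiny at \<open>(x, y)\<close>. By propagation of positivity and the Lipschitz bound it is then at
  most \<open>\<epsilon>\<close> at all points of a large neighbourhood, up to the boundary. Climb the staircase
  \<open>(x + i \<xi>, i \<tau>)\<close>: the value of \<open>U\<close> is \<open>0\<close> at the start and grows by at most \<open>\<epsilon>\<close> per step, so it is at
  most \<open>j \<epsilon>\<close> at height \<open>j \<tau>\<close>. The last step is chosen with \<open>1 - \<tau> \<le> j \<tau> \<le> 1\<close>. On the other
  hand the gap at height \<open>1 - \<tau>\<close> compares with the boundary value \<open>c\<close>, so that \<open>U\<close> is at least
  \<open>c - \<epsilon>\<close> at this height. Since \<open>U\<close> is nondecreasing in the last variable, \<open>c - \<epsilon> \<le> j \<epsilon>\<close>, which fails for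
  \<open>\<epsilon> = c / (j + 2)\<close>.
\<close>

lemma gap_bounded_below_inside:
  assumes \<tau>: "0 < \<tau>" "\<tau> < 1" and above: "slid_above \<xi> \<tau>" and \<delta>: "0 < \<delta>"
  shows "\<exists>m>0. \<forall>x y. \<delta> \<le> y \<longrightarrow> y \<le> 1 - \<tau> - \<delta> \<longrightarrow> m \<le> gap \<xi> \<tau> (x, y)"
proof -
  define j where "j = nat \<lfloor>1 / \<tau>\<rfloor>"
  have jr: "real j = of_int \<lfloor>1 / \<tau>\<rfloor>" using \<tau> by (simp add: j_def)
  have "real j \<le> 1 / \<tau>" "1 / \<tau> < real j + 1" unfolding jr by linarith+
  then have j: "real j * \<tau> \<le> 1" "1 - \<tau> \<le> real j * \<tau>" using \<tau> by (auto simp: field_simps)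
  define \<epsilon> where "\<epsilon> = c / (real j + 2)"
  have \<epsilon>: "0 < \<epsilon>" using c_pos by (simp add: \<epsilon>_def)
  \<comment> \<open>Points closer than \<open>\<delta>'\<close> to the boundary of the strip of the gap are handled by the Lipschitz bound
    at the cost \<open>\<epsilon> / 2\<close>.\<close>
  define \<delta>' where "\<delta>' = min \<delta> (min ((1 - \<tau>) / 2) (\<epsilon> / (4 * (K + 1))))"
  have "\<delta>' \<le> (1 - \<tau>) / 2" unfolding \<delta>'_def by linarith
  moreover have "0 < \<delta>'" "\<delta>' \<le> \<delta>" using \<delta> \<tau> \<epsilon> K_nonneg by (auto simp: \<delta>'_def)
  ultimately have \<delta>': "0 < \<delta>'" "\<delta>' \<le> \<delta>" "2 * \<delta>' \<le> 1 - \<tau>" by auto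
  have "2 * K * \<delta>' \<le> 2 * K * (\<epsilon> / (4 * (K + 1)))"
    using K_nonneg by (intro mult_left_mono) (auto simp: \<delta>'_def)
  also have "\<dots> \<le> \<epsilon> / 2" using K_nonneg \<epsilon> by (simp add: field_simps)
  finally have K\<delta>': "2 * K * \<delta>' \<le> \<epsilon> / 2" .
  define S where "S = (UNIV :: 'a set) \<times> {\<delta>'..1 - \<tau> - \<delta>'}"
  define \<Omega> where "\<Omega> = (UNIV :: 'a set) \<times> {0<..<1 - \<tau>}"
  have "\<exists>\<kappa>>0. \<forall>p\<in>S. \<forall>q\<in>S. dist p q \<le> real j * norm \<xi> + 1 \<longrightarrow> \<epsilon> / 2 \<le> gap \<xi> \<tau> p \<longrightarrow> \<kappa> \<le> gap \<xi> \<tau> q"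
  proof (rule propagation_of_positivity[of "\<delta>' / 2" L "2 * K" S \<Omega>])
    show "convex S" unfolding S_def by (intro convex_Times) auto
    fix p assume p: "p \<in> S"
    show "cball p (\<delta>' / 2) \<subseteq> \<Omega>"
    proof
      fix q assume "q \<in> cball p (\<delta>' / 2)"
      then have "\<bar>snd p - snd q\<bar> \<le> \<delta>' / 2" using dist_snd_le[of p q] by (simp add: dist_real_def)
      moreover have "\<delta>' \<le> snd p" "snd p \<le> 1 - \<tau> - \<delta>'" using p by (auto simp: S_def)
      ultimately have "0 < snd q" "snd q < 1 - \<tau>" using \<delta>' by linarith+
      then show "q \<in> \<Omega>" by (simp add: \<Omega>_def mem_Times_iff)
    qed
  next
    fix p assume "p \<in> \<Omega>"
    then have y: "0 < snd p" "snd p + \<tau> < 1" by (auto simp: \<Omega>_def)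
    show nn: "0 \<le> gap \<xi> \<tau> p"
      using above[unfolded slid_above_def, rule_format, of "snd p" "fst p"] y by simp
    show "\<exists>l. has_lap (gap \<xi> \<tau>) p l \<and> l \<le> L * gap \<xi> \<tau> p"
      using has_lap_gap[of "snd p" \<tau> \<xi> "fst p"] y \<tau> nn by (auto simp: abs_le_iff)
  next
    fix p q assume "p \<in> \<Omega>" "q \<in> \<Omega>"
    then show "\<bar>gap \<xi> \<tau> p - gap \<xi> \<tau> q\<bar> \<le> 2 * K * dist p q"
      using \<tau> by (intro gap_lipschitz) (auto simp: \<Omega>_def)
  qed (use \<delta>' \<epsilon> L_nonneg K_nonneg in auto)
  then obtain \<kappa> where \<kappa>: "0 < \<kappa>" "\<And>p q. p \<in> S \<Longrightarrow> q \<in> S \<Longrightarrow> dist p q \<le> real j * norm \<xi> + 1 \<Longrightarrow>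
    \<epsilon> / 2 \<le> gap \<xi> \<tau> p \<Longrightarrow> \<kappa> \<le> gap \<xi> \<tau> q" by blast
  show ?thesis
  proof (intro exI[of _ \<kappa>] conjI allI impI \<kappa>(1), rule ccontr)
    fix x y assume y: "\<delta> \<le> y" "y \<le> 1 - \<tau> - \<delta>" and "\<not> \<kappa> \<le> gap \<xi> \<tau> (x, y)"
    then have small_at: "gap \<xi> \<tau> (x, y) < \<kappa>" by simp
    have small: "gap \<xi> \<tau> (x + real i *\<^sub>R \<xi>, z) \<le> \<epsilon>" if i: "i \<le> j" and z: "0 \<le> z" "z \<le> 1 - \<tau>" for i z
    proof -
      \<comment> \<open>The height nearest to \<open>z\<close> at which propagation of positivity applies.\<close>
      define z' where "z' = max \<delta>' (min z (1 - \<tau> - \<delta>'))"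
      have z': "\<delta>' \<le> z'" "z' \<le> 1 - \<tau> - \<delta>'" "\<bar>z - z'\<bar> \<le> \<delta>'" using z \<delta>' by (auto simp: z'_def)
      have "dist (x + real i *\<^sub>R \<xi>, z') (x, y) \<le> norm (real i *\<^sub>R \<xi>) + \<bar>z' - y\<bar>"
        using norm_Pair_le[of "real i *\<^sub>R \<xi>" "z' - y"] by (simp add: dist_norm)
      also have "norm (real i *\<^sub>R \<xi>) \<le> real j * norm \<xi>" using i by (simp add: mult_right_mono)
      also have "\<bar>z' - y\<bar> \<le> 1" using z' y \<delta> \<delta>' \<tau> by auto
      finally have "gap \<xi> \<tau> (x + real i *\<^sub>R \<xi>, z') < \<epsilon> / 2"
        using \<kappa>(2)[of "(x + real i *\<^sub>R \<xi>, z')" "(x, y)"] small_at z' y \<delta>'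
        by (force simp: S_def)
      moreover have "\<bar>gap \<xi> \<tau> (x + real i *\<^sub>R \<xi>, z) - gap \<xi> \<tau> (x + real i *\<^sub>R \<xi>, z')\<bar> \<le> \<epsilon> / 2"
      proof -
        have "\<bar>gap \<xi> \<tau> (x + real i *\<^sub>R \<xi>, z) - gap \<xi> \<tau> (x + real i *\<^sub>R \<xi>, z')\<bar>
          \<le> 2 * K * dist (x + real i *\<^sub>R \<xi>, z) (x + real i *\<^sub>R \<xi>, z')"
          by (rule gap_lipschitz) (use z z' \<tau> \<delta>' in auto)
        also have "\<dots> \<le> 2 * K * \<delta>'"
          using z' K_nonneg by (intro mult_left_mono) (auto simp: dist_Pair_Pair dist_real_def)
        finally show ?thesis using K\<delta>' by simp
      qed
      ultimately show ?thesis by linarith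
    qed
    have stair: "U (x + real i *\<^sub>R \<xi>, real i * \<tau>) \<le> real i * \<epsilon>" if "i \<le> j" for i
      using that
    proof (induction i)
      case (Suc i)
      have "real (Suc i) * \<tau> \<le> real j * \<tau>" using Suc.prems \<tau> by (intro mult_right_mono) auto
      then have "real i * \<tau> \<le> 1 - \<tau>" using j by (simp add: algebra_simps)
      then have "gap \<xi> \<tau> (x + real i *\<^sub>R \<xi>, real i * \<tau>) \<le> \<epsilon>" using Suc.prems \<tau> by (intro small) auto
      moreover have "(x + real i *\<^sub>R \<xi>, real i * \<tau>) + (\<xi>, \<tau>) = (x + real (Suc i) *\<^sub>R \<xi>, real (Suc i) * \<tau>)"
        by (simp add: algebra_simps)
      ultimately have "U (x + real (Suc i) *\<^sub>R \<xi>, real (Suc i) * \<tau>)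
          \<le> U (x + real i *\<^sub>R \<xi>, real i * \<tau>) + \<epsilon>"
        unfolding gap_def by (simp only:)
      moreover have "real (Suc i) * \<epsilon> = real i * \<epsilon> + \<epsilon>" by (simp add: algebra_simps)
      ultimately show ?case using Suc by simp
    qed (simp add: bottom)
    have "c - U (x + real j *\<^sub>R \<xi>, 1 - \<tau>) \<le> \<epsilon>"
      using small[of j "1 - \<tau>"] \<tau> by (simp add: gap_def top)
    moreover have "U (x + real j *\<^sub>R \<xi>, 1 - \<tau>) \<le> U (x + real j *\<^sub>R \<xi>, real j * \<tau>)"
      using j \<tau> by (intro mono) auto
    ultimately have "c \<le> (real j + 1) * \<epsilon>" using stair[of j] by (simp add: algebra_simps)
    also have "\<dots> < (real j + 2) * \<epsilon>" using \<epsilon> by simp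
    also have "\<dots> = c" by (simp add: \<epsilon>_def)
    finally show False by simp
  qed
qed

text \<open>
  Away from the two boundary hyperplanes the gap is bounded below by some \<open>m > 0\<close>, and it stays
  nonnegative there when \<open>\<tau>\<close> is lowered a little. The two remaining strips are so
  narrow that the maximum principle extends nonnegativity to them; on the outer boundary
  it holds because \<open>0 \<le> U \<le> c\<close>.
\<close>

lemma slide_further:
  assumes \<tau>: "0 < \<tau>" "\<tau> < 1" and above: "slid_above \<xi> \<tau>"
  shows "\<exists>\<sigma>. 0 \<le> \<sigma> \<and> \<sigma> < \<tau> \<and> slid_above \<xi> \<sigma>"
proof -
  define \<delta> where "\<delta> = min ((1 - \<tau>) / 2) (1 / (2 * (L + 1)))"
  have \<delta>: "0 < \<delta>" "2 * \<delta> \<le> 1 - \<tau>" "2 * \<delta> * (L + 1) \<le> 1"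
    using \<tau> L_nonneg by (auto simp: \<delta>_def min_def field_simps)
  have narrow: "L * d\<^sup>2 < 2" if "0 \<le> d" "d \<le> 2 * \<delta>" for d
  proof -
    have "d * (L + 1) \<le> 1"
      using mult_right_mono[OF that(2), of "L + 1"] \<delta>(3) L_nonneg by linarith
    then have 1: "L * d \<le> 1" using that by (simp add: algebra_simps)
    have "d \<le> 1" using that \<delta>(2) \<tau> by linarith
    then have "L * d * d \<le> 1 * 1" using 1 that L_nonneg by (intro mult_mono) auto
    then show ?thesis by (simp add: power2_eq_square mult.assoc)
  qed
  obtain m where m: "0 < m" "\<And>x y. \<delta> \<le> y \<Longrightarrow> y \<le> 1 - \<tau> - \<delta> \<Longrightarrow> m \<le> gap \<xi> \<tau> (x, y)"
    using gap_bounded_below_inside[OF \<tau> above \<delta>(1)] by blast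
  define \<eta> where "\<eta> = min \<delta> (min \<tau> (m / (K + 1)))"
  have \<eta>: "0 < \<eta>" "\<eta> \<le> \<delta>" "\<eta> \<le> \<tau>" "\<eta> \<le> m / (K + 1)"
    using \<delta> \<tau> m K_nonneg by (auto simp: \<eta>_def)
  have "K * \<eta> \<le> (K + 1) * \<eta>" using \<eta> by simp
  also have "\<dots> \<le> m" using \<eta>(4) K_nonneg by (simp add: field_simps)
  finally have K\<eta>: "K * \<eta> \<le> m" .
  define \<sigma> where "\<sigma> = \<tau> - \<eta>"
  have \<sigma>: "0 \<le> \<sigma>" "\<sigma> < \<tau>" using \<eta> by (auto simp: \<sigma>_def)
  have middle: "0 \<le> gap \<xi> \<sigma> (x, y)" if y: "\<delta> \<le> y" "y \<le> 1 - \<tau> - \<delta>" for x y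
  proof -
    have "\<bar>U (x + \<xi>, y + \<tau>) - U (x + \<xi>, y + \<sigma>)\<bar> \<le> K * dist (x + \<xi>, y + \<tau>) (x + \<xi>, y + \<sigma>)"
      by (rule U_lipschitz) (use y \<tau> \<sigma> \<delta> in auto)
    also have "dist (x + \<xi>, y + \<tau>) (x + \<xi>, y + \<sigma>) = \<eta>"
      using \<eta> by (simp add: dist_Pair_Pair dist_real_def \<sigma>_def)
    finally have "\<bar>U (x + \<xi>, y + \<tau>) - U (x + \<xi>, y + \<sigma>)\<bar> \<le> m" using K\<eta> by simp
    then show ?thesis using m(2)[OF y, of x] by (simp add: gap_def)
  qed
  have "0 \<le> gap \<xi> \<sigma> (x, y)" if y: "0 \<le> y" "y + \<sigma> \<le> 1" for x y
  proof -
    consider "y \<le> \<delta>" | "\<delta> \<le> y" "y \<le> 1 - \<tau> - \<delta>" | "1 - \<tau> - \<delta> \<le> y" by linarith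
    then show ?thesis
    proof cases
      case 1
      show ?thesis
      proof (rule gap_nonneg_on_narrow_strip[of 0 \<sigma> \<delta>])
        show "0 \<le> gap \<xi> \<sigma> (x, 0)" for x by (rule gap_bottom_nonneg) (use \<sigma> \<tau> in auto)
        show "0 \<le> gap \<xi> \<sigma> (x, \<delta>)" for x by (rule middle) (use \<delta> in auto)
      qed (use 1 y \<sigma> \<tau> \<delta> narrow[of \<delta>] in auto)
    next
      case 3
      show ?thesis
      proof (rule gap_nonneg_on_narrow_strip[of "1 - \<tau> - \<delta>" \<sigma> "1 - \<sigma>"])
        show "0 \<le> gap \<xi> \<sigma> (x, 1 - \<tau> - \<delta>)" for x by (rule middle) (use \<delta> in auto)
        show "0 \<le> gap \<xi> \<sigma> (x, 1 - \<sigma>)" for x by (rule gap_top_nonneg) (use \<sigma> \<tau> in auto)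
        show "L * (1 - \<sigma> - (1 - \<tau> - \<delta>))\<^sup>2 < 2" by (rule narrow) (use \<delta> \<eta> in \<open>auto simp: \<sigma>_def\<close>)
      qed (use 3 y \<sigma> \<delta> in auto)
    qed (rule middle)
  qed
  with \<sigma> show ?thesis by (auto simp: slid_above_def)
qed

text \<open>
  Monotonicity of \<open>U\<close> in the last variable makes the set of admissible shifts an interval.
\<close>

lemma slid_above_mono:
  assumes "slid_above \<xi> \<tau>" "0 \<le> \<tau>" "\<tau> \<le> \<sigma>"
  shows "slid_above \<xi> \<sigma>"
  unfolding slid_above_def
proof (intro allI impI)
  fix x y assume y: "0 \<le> y" "y + \<sigma> \<le> 1"
  have "0 \<le> gap \<xi> \<tau> (x, y)" using assms y by (auto simp: slid_above_def)
  also have "\<dots> \<le> gap \<xi> \<sigma> (x, y)" using assms y by (auto simp: gap_def intro!: mono)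
  finally show "0 \<le> gap \<xi> \<sigma> (x, y)" .
qed

lemma slid_above_limit:
  assumes "0 \<le> \<tau>" and "\<And>\<sigma>. \<tau> < \<sigma> \<Longrightarrow> slid_above \<xi> \<sigma>"
  shows "slid_above \<xi> \<tau>"
  unfolding slid_above_def
proof (intro allI impI)
  fix x y assume y: "0 \<le> y" "y + \<tau> \<le> 1"
  show "0 \<le> gap \<xi> \<tau> (x, y)"
  proof (cases "y + \<tau> = 1")
    case True
    then show ?thesis using bounds[of y x] y assms by (simp add: gap_def top)
  next
    case False
    show ?thesis
    proof (rule field_le_epsilon)
      fix e :: real assume e: "0 < e"
      define h where "h = min (1 - y - \<tau>) (e / (K + 1))"
      have h: "0 < h" "y + \<tau> + h \<le> 1" "h \<le> e / (K + 1)" using False y e K_nonneg by (auto simp: h_def)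
      have "K * h \<le> (K + 1) * h" using h by simp
      also have "\<dots> \<le> e" using h(3) K_nonneg by (simp add: field_simps)
      finally have Kh: "K * h \<le> e" .
      have "0 \<le> gap \<xi> (\<tau> + h) (x, y)" using assms(2)[of "\<tau> + h"] h y by (simp add: slid_above_def)
      moreover have "\<bar>U (x + \<xi>, y + (\<tau> + h)) - U (x + \<xi>, y + \<tau>)\<bar>
          \<le> K * dist (x + \<xi>, y + (\<tau> + h)) (x + \<xi>, y + \<tau>)"
        by (rule U_lipschitz) (use y h assms(1) in auto)
      moreover have "dist (x + \<xi>, y + (\<tau> + h)) (x + \<xi>, y + \<tau>) = h"
        using h by (simp add: dist_Pair_Pair dist_real_def)
      ultimately show "0 \<le> gap \<xi> \<tau> (x, y) + e" using Kh by (simp add: gap_def)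
    qed
  qed
qed

text \<open>
  For \<open>\<tau>\<close> close to 1 the whole strip of the gap is narrow.
\<close>

lemma slid_above_initially: "\<exists>\<tau>. 0 < \<tau> \<and> \<tau> < 1 \<and> slid_above \<xi> \<tau>"
proof -
  define d where "d = 1 / (L + 2)"
  have d: "0 < d" "d < 1" "L * d\<^sup>2 < 2"
  proof -
    show "0 < d" "d < 1" using L_nonneg by (auto simp: d_def)
    have "L * d \<le> 1" using L_nonneg by (simp add: d_def)
    then have "L * d * d \<le> 1 * 1" using \<open>0 < d\<close> \<open>d < 1\<close> L_nonneg by (intro mult_mono) auto
    then show "L * d\<^sup>2 < 2" by (simp add: power2_eq_square mult.assoc)
  qed
  have "slid_above \<xi> (1 - d)"
    unfolding slid_above_def
  proof (intro allI impI)
    fix x y assume "0 \<le> y" "y + (1 - d) \<le> 1"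
    then have y: "0 \<le> y" "y \<le> d" by auto
    show "0 \<le> gap \<xi> (1 - d) (x, y)"
    proof (rule gap_nonneg_on_narrow_strip[of 0 "1 - d" d])
      show "0 \<le> gap \<xi> (1 - d) (x, 0)" for x by (rule gap_bottom_nonneg) (use d in auto)
      show "0 \<le> gap \<xi> (1 - d) (x, d)" for x using gap_top_nonneg[of "1 - d" \<xi> x] d by simp
    qed (use y d in auto)
  qed
  then show ?thesis using d by (intro exI[of _ "1 - d"] conjI) auto
qed

lemma slid_above_zero: "slid_above \<xi> 0"
proof -
  define T where "T = {\<tau>. 0 \<le> \<tau> \<and> slid_above \<xi> \<tau>}"
  obtain \<tau>1 where \<tau>1: "0 < \<tau>1" "\<tau>1 < 1" "\<tau>1 \<in> T"
    using slid_above_initially[of \<xi>] by (auto simp: T_def)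
  have bdd: "bdd_below T" by (auto simp: T_def intro: bdd_belowI[of _ 0])
  define \<tau>0 where "\<tau>0 = Inf T"
  have le: "\<tau>0 \<le> \<tau>" if "\<tau> \<in> T" for \<tau> unfolding \<tau>0_def by (rule cInf_lower[OF that bdd])
  have nn: "0 \<le> \<tau>0" unfolding \<tau>0_def
  proof (rule cInf_greatest)
    show "T \<noteq> {}" using \<tau>1 by blast
  qed (simp add: T_def)
  have "slid_above \<xi> \<tau>0"
  proof (rule slid_above_limit[OF nn])
    fix \<sigma> assume "\<tau>0 < \<sigma>"
    then obtain \<tau> where "\<tau> \<in> T" "\<tau> < \<sigma>"
      using cInf_lessD[of T \<sigma>] \<tau>1 by (auto simp: \<tau>0_def)
    then show "slid_above \<xi> \<sigma>" using slid_above_mono by (auto simp: T_def)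
  qed
  moreover have "\<tau>0 = 0"
  proof (rule ccontr)
    assume "\<tau>0 \<noteq> 0"
    then have "0 < \<tau>0" "\<tau>0 < 1" using nn le[OF \<tau>1(3)] \<tau>1 by auto
    from slide_further[OF this \<open>slid_above \<xi> \<tau>0\<close>] obtain \<sigma> where "\<sigma> \<in> T" "\<sigma> < \<tau>0"
      by (auto simp: T_def)
    with le show False by force
  qed
  ultimately show ?thesis by simp
qed

text \<open>
  A vertical shift by \<open>0\<close> compares two points at the same height, and \<open>\<xi>\<close> is arbitrary.
\<close>

lemma independent_of_horizontal:
  assumes "0 \<le> y" "y \<le> 1"
  shows "U (x, y) = U (0, y)"
proof (rule antisym)
  have "0 \<le> gap (- x) 0 (x, y)"
    using slid_above_zero[of "- x"] assms unfolding slid_above_def by simp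
  then show "U (x, y) \<le> U (0, y)" by (simp add: gap_def)
  have "0 \<le> gap x 0 (0, y)"
    using slid_above_zero[of x] assms unfolding slid_above_def by simp
  then show "U (0, y) \<le> U (x, y)" by (simp add: gap_def)
qed

end

section \<open>Strict monotonicity of the profile\<close>

context monotone_strip_solution
begin

definition v :: "real \<Rightarrow> real" where "v y = U (0, y)"

lemma U_eq_v: "0 \<le> y \<Longrightarrow> y \<le> 1 \<Longrightarrow> U (x, y) = v y"
  unfolding v_def by (rule independent_of_horizontal)

lemma v_deriv2:
  assumes y: "0 < y" "y < 1"
  shows "has_deriv2 (\<lambda>t. v (y + t)) (- f (v y))"
proof -
  obtain d where d: "\<And>b. b \<in> Basis \<Longrightarrow> has_deriv2 (\<lambda>t. U ((0, y) + t *\<^sub>R b)) (d b)"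
    "- f (U (0, y)) = sum d Basis"
    using equation[OF y, of 0] unfolding has_lap_def by blast
  \<comment> \<open>A constant function has only the second derivative \<open>0\<close>, by the minimum test for it and its negative.\<close>
  have "d (b, 0) = 0" if "b \<in> Basis" for b
  proof -
    have "has_deriv2 (\<lambda>t. v y) (d (b, 0))"
      using d(1)[of "(b, 0)"] that y by (simp add: Basis_prod_def U_eq_v)
    with has_deriv2_local_min[OF this] has_deriv2_local_min[OF has_deriv2_cmult[OF this, of "-1"]]
    show ?thesis by simp
  qed
  then have "- f (U (0, y)) = d (0, 1)"
    unfolding d(2) Basis_prod_def
    by (subst sum.union_disjoint) (auto simp: sum.reindex inj_on_def)
  with d(1)[of "(0, 1)"] show ?thesis by (simp add: Basis_prod_def v_def)
qed

lemma v_deriv: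
  assumes y: "0 < y" "y < 1"
  shows "(v has_real_derivative deriv v y) (at y)" "(deriv v has_real_derivative - f (v y)) (at y)"
proof -
  obtain g' where g': "\<forall>\<^sub>F t in nhds 0. ((\<lambda>t. v (y + t)) has_real_derivative g' t) (at t)"
    "(g' has_real_derivative - f (v y)) (at 0)"
    using v_deriv2[OF y] unfolding has_deriv2_def by blast
  have ev: "\<forall>\<^sub>F t in nhds 0. (v has_real_derivative g' t) (at (y + t))"
    using g'(1) by (rule eventually_mono) (simp add: DERIV_shift[of v _ _ y, unfolded add.commute[of _ y]])
  have D: "\<forall>\<^sub>F t in nhds 0. deriv v (y + t) = g' t"
    using ev by (rule eventually_mono) (rule DERIV_imp_deriv)
  from eventually_nhds_x_imp_x[OF ev] eventually_nhds_x_imp_x[OF D]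
  show "(v has_real_derivative deriv v y) (at y)" by simp
  have "((\<lambda>t. deriv v (y + t)) has_real_derivative - f (v y)) (at 0)"
    using DERIV_cong_ev[OF refl D refl] g'(2) by simp
  then show "(deriv v has_real_derivative - f (v y)) (at y)"
    using DERIV_shift[of "deriv v" _ 0 y] by (simp add: add.commute)
qed

lemma v_deriv_nonneg:
  assumes y: "0 < y" "y < 1"
  shows "0 \<le> deriv v y"
proof (rule mono_on_imp_deriv_nonneg)
  show "mono_on {0..1} v" by (auto simp: mono_on_def v_def intro: mono)
  show "(v has_real_derivative deriv v y) (at y)" by (rule v_deriv[OF y])
qed (use y in simp)

text \<open>
  If the derivative of the profile vanished at an interior point, it would be minimal there, so the
  second derivative \<open>- f (v t)\<close> would vanish as well. Then the constant \<open>v t\<close> solves the same ordinary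
  differential equation with the same initial data; uniqueness makes the profile constant, but it goes
  from \<open>0\<close> to \<open>c > 0\<close>. Uniqueness is Gronwall's argument for the energy
  \<open>z = (v - v t)\<^sup>2 + v'\<^sup>2\<close>, which satisfies \<open>|z'| \<le> (1 + L) z\<close>.
\<close>

lemma v_deriv_pos:
  assumes t: "0 < t" "t < 1"
  shows "0 < deriv v t"
proof (rule ccontr)
  assume "\<not> 0 < deriv v t"
  then have D0: "deriv v t = 0" using v_deriv_nonneg[OF t] by simp
  have "- f (v t) = 0"
  proof (rule DERIV_local_min[OF v_deriv(2)[OF t]])
    show "0 < min t (1 - t)" using t by simp
    show "\<forall>y. \<bar>t - y\<bar> < min t (1 - t) \<longrightarrow> deriv v t \<le> deriv v y"
      using D0 v_deriv_nonneg by (auto simp: abs_less_iff)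
  qed
  then have f0: "f (v t) = 0" by simp
  define z where "z = (\<lambda>y. (v y - v t)\<^sup>2 + (deriv v y)\<^sup>2)"
  define z' where "z' = (\<lambda>y. 2 * (v y - v t) * deriv v y + 2 * deriv v y * (- f (v y)))"
  have z': "(z has_real_derivative z' y) (at y)" if "0 < y" "y < 1" for y
    unfolding z_def z'_def
    by (rule derivative_eq_intros v_deriv that refl)+ simp
  \<comment> \<open>In \<open>z'\<close> the first summand is at most \<open>z\<close> and, as \<open>f (v t) = 0\<close>, the second is at most \<open>L z\<close>.\<close>
  define M where "M = 1 + L"
  have bound: "\<bar>z' y\<bar> \<le> M * z y" if y: "0 < y" "y < 1" for y
  proof -
    have "0 \<le> v y \<and> v y \<le> c" "0 \<le> v t \<and> v t \<le> c" using bounds y t by (auto simp: v_def)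
    then have "\<bar>f (v y)\<bar> \<le> L * \<bar>v y - v t\<bar>"
      using lipschitz_onD[OF f_lipschitz, of "v y" "v t"] f0 by (simp add: dist_real_def)
    then have "\<bar>2 * deriv v y * (- f (v y))\<bar> \<le> 2 * \<bar>deriv v y\<bar> * (L * \<bar>v y - v t\<bar>)"
      by (simp add: abs_mult mult_left_mono)
    moreover have "2 * \<bar>v y - v t\<bar> * \<bar>deriv v y\<bar> \<le> z y"
      using sum_squares_bound[of "\<bar>v y - v t\<bar>" "\<bar>deriv v y\<bar>"] by (simp add: z_def)
    ultimately have "\<bar>z' y\<bar> \<le> z y + L * z y"
    proof -
      have "\<bar>z' y\<bar> \<le> \<bar>2 * (v y - v t) * deriv v y\<bar> + \<bar>2 * deriv v y * (- f (v y))\<bar>"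
        unfolding z'_def by (rule abs_triangle_ineq)
      also have "\<bar>2 * (v y - v t) * deriv v y\<bar> = 2 * \<bar>v y - v t\<bar> * \<bar>deriv v y\<bar>"
        by (simp only: abs_mult abs_numeral)
      also have "\<dots> \<le> z y" by fact
      also have "\<bar>2 * deriv v y * (- f (v y))\<bar> \<le> 2 * \<bar>deriv v y\<bar> * (L * \<bar>v y - v t\<bar>)" by fact
      also have "\<dots> = L * (2 * \<bar>v y - v t\<bar> * \<bar>deriv v y\<bar>)" by simp
      also have "\<dots> \<le> L * z y" by (rule mult_left_mono) (fact, rule L_nonneg)
      finally show ?thesis by simp
    qed
    then show ?thesis by (simp add: M_def algebra_simps)
  qed
  have zt: "z t = 0" using D0 by (simp add: z_def)
  have z0: "z y \<le> 0" if y: "0 < y" "y < 1" for y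
  proof (cases "t \<le> y")
    case True
    have "z y * exp (- M * y) \<le> z t * exp (- M * t)"
    proof (rule DERIV_nonpos_imp_nonincreasing[OF True])
      fix s assume "t \<le> s" "s \<le> y"
      then have s: "0 < s" "s < 1" using y t by auto
      have "((\<lambda>s. z s * exp (- M * s)) has_real_derivative (z' s - M * z s) * exp (- M * s)) (at s)"
        by (rule derivative_eq_intros z'[OF s] refl)+ (simp add: algebra_simps)
      moreover have "(z' s - M * z s) * exp (- M * s) \<le> 0"
        using bound[OF s] by (intro mult_nonpos_nonneg) auto
      ultimately show "\<exists>k. ((\<lambda>s. z s * exp (- M * s)) has_real_derivative k) (at s) \<and> k \<le> 0" by blast
    qed
    then show ?thesis by (simp add: zt mult_le_0_iff)
  next
    case False
    have "z y * exp (M * y) \<le> z t * exp (M * t)"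
    proof (rule DERIV_nonneg_imp_nondecreasing[where f = "\<lambda>s. z s * exp (M * s)"])
      fix s assume "y \<le> s" "s \<le> t"
      then have s: "0 < s" "s < 1" using y t by auto
      have "((\<lambda>s. z s * exp (M * s)) has_real_derivative (z' s + M * z s) * exp (M * s)) (at s)"
        by (rule derivative_eq_intros z'[OF s] refl)+ (simp add: algebra_simps)
      moreover have "0 \<le> (z' s + M * z s) * exp (M * s)"
        using bound[OF s] by (intro mult_nonneg_nonneg) auto
      ultimately show "\<exists>k. ((\<lambda>s. z s * exp (M * s)) has_real_derivative k) (at s) \<and> 0 \<le> k" by blast
    qed (use False in simp)
    then show ?thesis by (simp add: zt mult_le_0_iff)
  qed
  have const: "v y = v t" if "0 < y" "y < 1" for y
    using z0[OF that] by (simp add: z_def sum_power2_le_zero_iff)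
  \<comment> \<open>The Lipschitz bound carries the constant value to the end points.\<close>
  have "\<bar>v 1 - v 0\<bar> \<le> e" if e: "0 < e" for e
  proof -
    define h where "h = min (1 / 2) (e / (2 * (K + 1)))"
    have h: "h \<le> 1 / 2" "h \<le> e / (2 * (K + 1))" unfolding h_def by (rule min.cobounded1 min.cobounded2)+
    have h_pos: "0 < h" using e K_nonneg by (simp add: h_def)
    have "2 * K * h \<le> 2 * (K + 1) * h" using h_pos by simp
    also have "\<dots> \<le> e" using h(2) K_nonneg by (simp add: field_simps)
    finally have Kh: "2 * K * h \<le> e" .
    have "\<bar>v 0 - v h\<bar> \<le> K * h" "\<bar>v 1 - v (1 - h)\<bar> \<le> K * h"
      using U_lipschitz[of "(0, 0)" "(0, h)"] U_lipschitz[of "(0, 1)" "(0, 1 - h)"] h h_pos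
      by (auto simp: v_def dist_Pair_Pair dist_real_def)
    moreover have "v h = v (1 - h)" using const[of h] const[of "1 - h"] h h_pos by simp
    ultimately show ?thesis using Kh by linarith
  qed
  from this[of "c / 2"] show False using c_pos by (simp add: v_def bottom top)
qed

end

section \<open>From one-sided partial derivatives to pointwise Laplacians\<close>

text \<open>
  At interior points the filter in the definition of partial derivatives is the full neighbourhood
  filter, so that partial derivatives within a set and within any smaller neighbourhood agree.
\<close>

lemma partial_eq_at_0:
  fixes x b :: "'a::real_normed_vector"
  assumes "x \<in> interior S"
  shows "at 0 within {t::real. x + t *\<^sub>R b \<in> S} = at 0"
proof (rule at_within_interior)
  have "open ((\<lambda>t::real. x + t *\<^sub>R b) -` interior S)"
    by (intro open_vimage continuous_intros open_interior)
  then show "0 \<in> interior {t::real. x + t *\<^sub>R b \<in> S}"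
    using assms interior_subset[of S]
    by (intro interiorI[of "(\<lambda>t::real. x + t *\<^sub>R b) -` interior S"]) auto
qed

lemma has_derivative_partial:
  assumes "x \<in> interior S" "partial_exists S b u x"
  shows "((\<lambda>t. u (x + t *\<^sub>R b)) has_real_derivative partial S b u x) (at 0)"
  using assms(2) unfolding partial_exists_def partial_def partial_eq_at_0[OF assms(1)]
  by (simp add: has_real_derivative_iff_has_vector_derivative vector_derivative_works)

lemma eventually_line_interior:
  fixes x b :: "'a::real_normed_vector"
  assumes "x \<in> interior S"
  shows "\<forall>\<^sub>F t in nhds (0::real). x + t *\<^sub>R b \<in> interior S"
proof -
  have "((\<lambda>t::real. x + t *\<^sub>R b) \<longlongrightarrow> x + 0 *\<^sub>R b) (nhds 0)"
    by (intro tendsto_intros filterlim_ident)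
  moreover have "\<forall>\<^sub>F y in nhds x. y \<in> interior S"
    using assms by (intro eventually_nhds_in_open) auto
  ultimately show ?thesis
    using eventually_compose_filterlim[of "\<lambda>y. y \<in> interior S" "nhds x" "\<lambda>t. x + t *\<^sub>R b" "nhds (0::real)"] by simp
qed

lemma has_deriv2_partial:
  assumes x: "x \<in> interior S" and ex: "\<And>x. x \<in> S \<Longrightarrow> partial_exists S b u x"
    "\<And>x. x \<in> S \<Longrightarrow> partial_exists S b (partial S b u) x"
  shows "has_deriv2 (\<lambda>t. u (x + t *\<^sub>R b)) (partial S b (partial S b u) x)"
proof (rule has_deriv2I)
  have S: "z \<in> S" if "z \<in> interior S" for z using that interior_subset by blast
  show "((\<lambda>t. partial S b u (x + t *\<^sub>R b)) has_real_derivative partial S b (partial S b u) x) (at 0)"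
    by (intro has_derivative_partial x ex S)
  show "\<forall>\<^sub>F t in nhds 0. ((\<lambda>t. u (x + t *\<^sub>R b)) has_real_derivative partial S b u (x + t *\<^sub>R b)) (at t)"
    using eventually_line_interior[OF x]
  proof (rule eventually_mono)
    fix t :: real assume t: "x + t *\<^sub>R b \<in> interior S"
    have "((\<lambda>s. u ((x + t *\<^sub>R b) + s *\<^sub>R b)) has_real_derivative partial S b u (x + t *\<^sub>R b)) (at 0)"
      by (intro has_derivative_partial t ex S)
    then show "((\<lambda>t. u (x + t *\<^sub>R b)) has_real_derivative partial S b u (x + t *\<^sub>R b)) (at t)"
      using DERIV_shift[of "\<lambda>t. u (x + t *\<^sub>R b)" _ 0 t] by (simp add: algebra_simps)
  qed
qed

lemma partial_interior_eq:
  assumes "x \<in> interior S" "x \<in> interior T"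
  shows "partial S b u x = partial T b u x"
  unfolding partial_def partial_eq_at_0[OF assms(1)] partial_eq_at_0[OF assms(2)] ..

lemma partial_partial_subset:
  assumes T: "open T" "T \<subseteq> S" and x: "x \<in> T" and ex: "\<And>x. x \<in> S \<Longrightarrow> partial_exists S b (partial S b u) x"
  shows "partial T b (partial T b u) x = partial S b (partial S b u) x"
proof -
  have TS: "T \<subseteq> interior S" using T by (rule interior_maximal[rotated])
  have iT: "interior T = T" using T by (simp add: interior_open)
  have "((\<lambda>t. partial S b u (x + t *\<^sub>R b)) has_real_derivative partial S b (partial S b u) x) (at 0)"
    using x T TS by (intro has_derivative_partial ex) auto
  moreover have "\<forall>\<^sub>F t in nhds 0. partial T b u (x + t *\<^sub>R b) = partial S b u (x + t *\<^sub>R b)"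
    using eventually_line_interior[of x T b] x iT TS
    by (auto elim!: eventually_mono intro!: partial_interior_eq)
  ultimately have "((\<lambda>t. partial T b u (x + t *\<^sub>R b)) has_real_derivative partial S b (partial S b u) x) (at 0)"
    by (subst DERIV_cong_ev[OF refl _ refl])
  then show ?thesis
    unfolding partial_def[of T b "partial T b u"] using x iT
    by (simp add: partial_eq_at_0 has_real_derivative_iff_has_vector_derivative vector_derivative_at)
qed

theorem theorem1p6:
  fixes f :: "real \<Rightarrow> real"
    and u :: "(real ^ 'm) \<times> real \<Rightarrow> real"
    and c :: real
  assumes "local_lipschitz (UNIV :: real set) UNIV (\<lambda>_. f)"
    and "Ck_on 2 (closure strip) u"
    and "bounded (u ` closure strip)"
    and "\<forall>x\<in>strip. laplacian strip u x + f (u x) = 0"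
    and "c > 0"
    and "\<forall>x'. u (x', 0) = 0"
    and "\<forall>x'. u (x', 1) = c"
    and "\<forall>x\<in>closure strip. partial (closure strip) (0, 1) u x \<ge> 0"
  shows "\<exists>v :: real \<Rightarrow> real.
    (\<forall>x\<in>closure strip. u x = v (snd x)) \<and>
    (\<forall>t. 0 < t \<and> t < 1 \<longrightarrow> v differentiable (at t) \<and> deriv v t > 0)"
proof -
  let ?S = "closure strip :: ((real ^ 'm) \<times> real) set"
  have S: "?S = UNIV \<times> {0..1}" by (rule closure_strip)
  have strip: "open (strip :: ((real ^ 'm) \<times> real) set)" "strip \<subseteq> ?S"
    by (auto simp: strip_def open_Times closure_subset S)
  have int: "(x, y) \<in> strip \<and> (x, y) \<in> interior ?S" if "0 < y" "y < 1" for x :: "real ^ 'm" and y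
    using that interior_maximal[OF strip(2,1)] by (auto simp: strip_def)
  have C2: "continuous_on ?S u"
    and p1: "\<And>b x. b \<in> Basis \<Longrightarrow> x \<in> ?S \<Longrightarrow> partial_exists ?S b u x"
    and p2: "\<And>b x. b \<in> Basis \<Longrightarrow> x \<in> ?S \<Longrightarrow> partial_exists ?S b (partial ?S b u) x"
    using assms(2) by (auto simp: numeral_2_eq_2)
  have eq: "has_lap u (x, y) (- f (u (x, y)))" if y: "0 < y" "y < 1" for x y
  proof -
    have "- f (u (x, y)) = laplacian strip u (x, y)"
      using assms(4)[rule_format, of "(x, y)"] int[OF y, of x] by simp
    also have "\<dots> = (\<Sum>b\<in>Basis. partial ?S b (partial ?S b u) (x, y))"
      unfolding laplacian_def using int[OF y, of x] p2
      by (intro sum.cong refl partial_partial_subset strip) auto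
    finally show ?thesis
      unfolding has_lap_def using int[OF y, of x] p1 p2
      by (intro exI[of _ "\<lambda>b. partial ?S b (partial ?S b u) (x, y)"] conjI ballI has_deriv2_partial) auto
  qed
  have mono: "u (x, y) \<le> u (x, z)" if yz: "0 \<le> y" "y \<le> z" "z \<le> 1" for x y z
  proof (rule DERIV_nonneg_imp_increasing_open[OF yz(2)])
    show "continuous_on {y..z} (\<lambda>s. u (x, s))"
      by (rule continuous_on_compose2[OF C2]) (use yz in \<open>auto simp: S intro!: continuous_intros\<close>)
    fix s assume s: "y < s" "s < z"
    have "((\<lambda>t. u ((x, s) + t *\<^sub>R (0, 1))) has_real_derivative partial ?S (0, 1) u (x, s)) (at 0)"
      using int[of s x] s yz by (intro has_derivative_partial p1) (auto simp: S Basis_prod_def)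
    then have "((\<lambda>s. u (x, s)) has_real_derivative partial ?S (0, 1) u (x, s)) (at s)"
      using DERIV_shift[of "\<lambda>s. u (x, s)" _ 0 s] by (simp add: add.commute)
    then show "\<exists>d. ((\<lambda>s. u (x, s)) has_real_derivative d) (at s) \<and> 0 \<le> d"
      using assms(8) s yz by (auto simp: S)
  qed
  have bounds: "0 \<le> u (x, y) \<and> u (x, y) \<le> c" if "0 \<le> y" "y \<le> 1" for x y
    using mono[of 0 y x] mono[of y 1 x] that assms(6,7) by simp
  have "local_lipschitz {0::real} {0..c} (\<lambda>_. f)"
    using assms(1) by (rule local_lipschitz_subset) auto
  from local_lipschitz_compact_implies_lipschitz[OF this] obtain L where L: "L-lipschitz_on {0..c} f"
    by auto
  define N where "N = \<bar>f 0\<bar> + L * c"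
  have f_bound: "\<bar>f s\<bar> \<le> N" if "0 \<le> s" "s \<le> c" for s
  proof -
    have "\<bar>f s - f 0\<bar> \<le> L * \<bar>s - 0\<bar>" using lipschitz_onD[OF L, of s 0] that by (simp add: dist_real_def)
    also have "\<dots> \<le> L * c" using that lipschitz_on_nonneg[OF L] by (intro mult_left_mono) auto
    finally show ?thesis by (simp add: N_def)
  qed
  interpret monotone_strip_solution u N c f L
  proof
    show "continuous_on (UNIV \<times> {0..1}) u" using C2 by (simp add: S)
    show "\<exists>l. has_lap u (x, y) l \<and> \<bar>l\<bar> \<le> N" if "0 < y" "y < 1" for x y
      using eq[OF that, of x] f_bound[of "u (x, y)"] bounds[of y x] that
      by (intro exI[of _ "- f (u (x, y))"]) auto
  qed (use bounds mono eq L assms(5-7) in auto)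
  show ?thesis
  proof (intro exI[of _ v] conjI ballI allI impI)
    fix x assume "x \<in> ?S"
    then show "u x = v (snd x)" using U_eq_v[of "snd x" "fst x"] by (auto simp: S)
  next
    fix t :: real assume t: "0 < t \<and> t < 1"
    then show "v differentiable (at t)" "0 < deriv v t"
      using v_deriv(1) v_deriv_pos by (auto simp: real_differentiable_def)
  qed
qed

end
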